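(* Let $K\subset\mathbb{C}$ be an open disk and $\varphi:\partial K\to(0,+\infty)$ a continuous function. Then there exists a unique regular conformal metric $\lambda(z)\,|dz|$ with constant curvature $-1$ on $K$ such that $\lambda$ is continuous on the closure $\overline{K}$ of $K$ and $\lambda(\xi)=\varphi(\xi)$ for all $\xi\in\partial K$.
   Context: A regular conformal metric $\lambda(z)\,|dz|$ on a domain $G\subseteq\mathbb{C}$ is given by a function $\lambda:G\to(0,+\infty)$ of class $C^2$. Its curvature is $\kappa_\lambda(z)=-\Delta(\log\lambda)(z)/\lambda(z)^2$, where $\Delta=\partial_x^2+\partial_y^2$. "Continuous on $\overline{K}$" means that $\lambda$ extends continuously to $\overline{K}$. *)

theory Defs
  imports "HOL-Analysis.Analysis"
begin

text \<open>For \<open>b = 1\<close> and \<open>b = \<i>\<close>, the two elements of \<^term>\<open>Basis :: complex set\<close>, this is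
  \<open>\<partial>u/\<partial>x\<close> and \<open>\<partial>u/\<partial>y\<close>.\<close>

definition partial_deriv :: "complex \<Rightarrow> (complex \<Rightarrow> real) \<Rightarrow> complex \<Rightarrow> real" where
  "partial_deriv b u z = deriv (\<lambda>t::real. u (z + t *\<^sub>R b)) 0"

text \<open>Class \<open>C\<^sup>k\<close> on \<open>G\<close> (meant for open \<open>G\<close>). Existence of the partial derivatives is
  required explicitly because \<^const>\<open>deriv\<close> is total.\<close>

primrec Ck_on :: "nat \<Rightarrow> (complex \<Rightarrow> real) \<Rightarrow> complex set \<Rightarrow> bool" where
  "Ck_on 0 u G \<longleftrightarrow> continuous_on G u"
| "Ck_on (Suc k) u G \<longleftrightarrow> continuous_on G u \<and>
     (\<forall>b\<in>Basis. (\<forall>z\<in>G. (\<lambda>t::real. u (z + t *\<^sub>R b)) field_differentiable at 0) \<and>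
        Ck_on k (partial_deriv b u) G)"

definition laplacian :: "(complex \<Rightarrow> real) \<Rightarrow> complex \<Rightarrow> real" where
  "laplacian u z = partial_deriv 1 (partial_deriv 1 u) z + partial_deriv \<i> (partial_deriv \<i> u) z"

definition regular_conformal_metric :: "complex set \<Rightarrow> (complex \<Rightarrow> real) \<Rightarrow> bool" where
  "regular_conformal_metric G l \<longleftrightarrow>
     open G \<and> connected G \<and> G \<noteq> {} \<and> (\<forall>z\<in>G. l z > 0) \<and> Ck_on 2 l G"

definition curvature :: "(complex \<Rightarrow> real) \<Rightarrow> complex \<Rightarrow> real" where
  "curvature l z = - laplacian (\<lambda>w. ln (l w)) z / (l z)\<^sup>2"

end

theory Submission
  imports Defs
begin

text \<open>
  Write \<open>l = exp u\<close>. The curvature of \<open>l\<close> is \<open>- 1\<close> exactly when \<open>\<Delta>u = exp (2 * u)\<close>, so the theorem is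
  the Dirichlet problem for Liouville's equation on a disk. Everything rests on the maximum principle:
  the Laplacian of a \<open>C\<^sup>2\<close> function is nonpositive at an interior maximum. Uniqueness is immediate from
  it (\<open>liouville_dirichlet_le\<close>), because \<open>exp (2 * u) > exp (2 * v)\<close> where \<open>u > v\<close>.

  Existence needs no integral kernels. The pairs \<open>(u, f)\<close> that are uniform limits of classical pairs
  \<open>(v, \<Delta>v)\<close> form a notion of weak solution of \<open>\<Delta>u = f\<close> that still obeys the maximum principle
  (\<open>weak_laplacian\<close>, \<open>maximum_principle\<close>). For polynomial data on a disk the linear problem has an
  explicit solution; the Weierstrass theorem and the maximum principle extend this to continuous
  data (\<open>dirichlet_problem\<close>).

  For a monotone Lipschitz function \<open>F\<close>, the equation \<open>\<Delta>u = F(u)\<close> is reached from \<open>\<Delta>u = 0\<close> by the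
  continuity method. Each step is a contraction, and its admissible length does not shrink along the
  way, because the monotone part of the equation never hurts in the maximum principle
  (\<open>semilinear_contraction\<close>, \<open>semilinear_dirichlet_problem\<close>). Truncating the exponential above the
  boundary values makes it Lipschitz without changing the solution.

  What remains is to show that weak solutions are classical (\<open>weak_laplacian_regularity\<close>). An interior
  gradient estimate, obtained from a barrier on half of a square (\<open>interior_gradient_estimate\<close>),
  makes the gradients of the approximants converge, so \<open>u\<close> is \<open>C\<^sup>1\<close>. Then \<open>f = exp (2 * u)\<close> is
  \<open>C\<^sup>1\<close> as well, the derivatives of \<open>u\<close> are weak solutions with right sides the derivatives of \<open>f\<close>, and
  a second use of the estimate shows that \<open>u\<close> is \<open>C\<^sup>2\<close>.
\<close>

section \<open>Calculus of partial derivatives\<close>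

definition has_partial :: "complex \<Rightarrow> (complex \<Rightarrow> real) \<Rightarrow> real \<Rightarrow> complex \<Rightarrow> bool" where
  "has_partial b u D z \<longleftrightarrow> ((\<lambda>t::real. u (z + t *\<^sub>R b)) has_field_derivative D) (at 0)"

lemma partial_deriv_eqI: "has_partial b u D z \<Longrightarrow> partial_deriv b u z = D"
  unfolding has_partial_def partial_deriv_def by (rule DERIV_imp_deriv)

lemma has_partial_iff_differentiable:
  "has_partial b u (partial_deriv b u z) z \<longleftrightarrow> (\<lambda>t::real. u (z + t *\<^sub>R b)) field_differentiable at 0"
  unfolding has_partial_def partial_deriv_def
  by (rule DERIV_deriv_iff_field_differentiable)

lemma has_partial_along_line:
  assumes "has_partial b u D (z + s *\<^sub>R b)"
  shows "((\<lambda>t. u (z + t *\<^sub>R b)) has_field_derivative D) (at s)"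
proof -
  have "((\<lambda>t. u (z + t *\<^sub>R b)) has_field_derivative D) (at (0 + s))"
    using assms unfolding has_partial_def DERIV_shift by (simp add: algebra_simps)
  then show ?thesis by simp
qed

lemma eventually_on_line:
  fixes z b :: complex
  assumes "open G" "z \<in> G"
  shows "\<forall>\<^sub>F t::real in nhds 0. z + t *\<^sub>R b \<in> G"
proof -
  have "open ((\<lambda>t::real. z + t *\<^sub>R b) -` G)"
    by (intro open_vimage assms(1) continuous_intros)
  moreover have "0 \<in> (\<lambda>t::real. z + t *\<^sub>R b) -` G" using assms by simp
  ultimately show ?thesis by (auto simp: eventually_nhds)
qed

lemma has_partial_cong:
  assumes "open G" "z \<in> G" "\<And>w. w \<in> G \<Longrightarrow> u w = v w"
  shows "has_partial b u D z \<longleftrightarrow> has_partial b v D z"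
  unfolding has_partial_def
  by (rule DERIV_cong_ev)
    (auto intro: eventually_mono[OF eventually_on_line[OF assms(1,2)]] assms(3))

lemma partial_deriv_cong:
  assumes "open G" "z \<in> G" "\<And>w. w \<in> G \<Longrightarrow> u w = v w"
  shows "partial_deriv b u z = partial_deriv b v z"
  unfolding partial_deriv_def
  by (rule deriv_cong_ev)
    (auto intro: eventually_mono[OF eventually_on_line[OF assms(1,2)]] assms(3))

lemma Ck_on_Suc:
  "Ck_on (Suc k) u G \<longleftrightarrow> continuous_on G u \<and>
     (\<forall>b\<in>Basis. (\<forall>z\<in>G. has_partial b u (partial_deriv b u z) z) \<and> Ck_on k (partial_deriv b u) G)"
  by (simp add: has_partial_iff_differentiable)

declare Ck_on.simps(2) [simp del]

lemma Ck_on_continuous: "Ck_on k u G \<Longrightarrow> continuous_on G u"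
  by (cases k) (auto simp: Ck_on_Suc)

lemma Ck_on_has_partial:
  "\<lbrakk>Ck_on (Suc k) u G; b \<in> Basis; z \<in> G\<rbrakk> \<Longrightarrow> has_partial b u (partial_deriv b u z) z"
  by (auto simp: Ck_on_Suc)

lemma Ck_on_partial: "\<lbrakk>Ck_on (Suc k) u G; b \<in> Basis\<rbrakk> \<Longrightarrow> Ck_on k (partial_deriv b u) G"
  by (auto simp: Ck_on_Suc)

lemma Ck_on_cong:
  assumes "open G" "\<And>w. w \<in> G \<Longrightarrow> u w = v w" "Ck_on k u G"
  shows "Ck_on k v G"
  using assms
proof (induction k arbitrary: u v)
  case 0
  then show ?case by (simp cong: continuous_on_cong)
next
  case (Suc k)
  have cong: "partial_deriv b u z = partial_deriv b v z" if "z \<in> G" for b z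
    using Suc.prems(1,2) that by (intro partial_deriv_cong)
  have "continuous_on G v"
    using Ck_on_continuous[OF Suc.prems(3)] Suc.prems(2) by (simp cong: continuous_on_cong)
  moreover have "has_partial b v (partial_deriv b v z) z" if "b \<in> Basis" "z \<in> G" for b z
    using Ck_on_has_partial[OF Suc.prems(3) that]
      has_partial_cong[OF Suc.prems(1) that(2), of u v] Suc.prems(2)
    unfolding cong[OF that(2)] by blast
  moreover have "Ck_on k (partial_deriv b v) G" if "b \<in> Basis" for b
    by (rule Suc.IH[OF Suc.prems(1) cong Ck_on_partial[OF Suc.prems(3) that]])
  ultimately show ?case by (auto simp: Ck_on_Suc)
qed

text \<open>A class membership can be checked with explicit formulas \<open>D b\<close> for the derivatives instead of
  the total \<^const>\<open>partial_deriv\<close>, because on an open set the two agree near every point.\<close>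

lemma Ck_on_SucI:
  assumes "open G" "continuous_on G u"
    and "\<And>b z. b \<in> Basis \<Longrightarrow> z \<in> G \<Longrightarrow> has_partial b u (D b z) z"
    and "\<And>b. b \<in> Basis \<Longrightarrow> Ck_on k (D b) G"
  shows "Ck_on (Suc k) u G"
  unfolding Ck_on_Suc
proof (intro conjI ballI)
  fix b :: complex assume b: "b \<in> Basis"
  show "has_partial b u (partial_deriv b u z) z" if "z \<in> G" for z
    using assms(3)[OF b that] partial_deriv_eqI by simp
  show "Ck_on k (partial_deriv b u) G"
    using partial_deriv_eqI[OF assms(3)[OF b]]
    by (intro Ck_on_cong[OF assms(1) _ assms(4)[OF b]]) simp
qed (rule assms(2))

lemma Ck_on_mono: "Ck_on k u G \<Longrightarrow> H \<subseteq> G \<Longrightarrow> Ck_on k u H"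
  by (induction k arbitrary: u) (auto simp: Ck_on_Suc intro: continuous_on_subset)

lemma Ck_on_SucD: "Ck_on (Suc k) u G \<Longrightarrow> Ck_on k u G"
  by (induction k arbitrary: u) (auto simp: Ck_on_Suc)

lemma Ck_on_local:
  assumes "\<And>z. z \<in> G \<Longrightarrow> \<exists>H. open H \<and> z \<in> H \<and> Ck_on k u H"
  shows "Ck_on k u G"
  using assms
proof (induction k arbitrary: u)
  have cont: "continuous_on G u" if "\<And>z. z \<in> G \<Longrightarrow> \<exists>H. open H \<and> z \<in> H \<and> continuous_on H u" for u
    using that by (meson continuous_at_imp_continuous_on continuous_on_eq_continuous_at)
  {
    case 0
    show ?case unfolding Ck_on.simps(1) by (rule cont) (use 0 in simp)
  next
    case (Suc k)
    have "continuous_on G u" using Suc.prems Ck_on_continuous by (intro cont) blast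
    moreover have "has_partial b u (partial_deriv b u z) z" if "b \<in> Basis" "z \<in> G" for b z
      using Suc.prems[OF that(2)] that by (auto simp: Ck_on_Suc)
    moreover have "Ck_on k (partial_deriv b u) G" if b: "b \<in> Basis" for b
      using Suc.prems Ck_on_partial[OF _ b] by (intro Suc.IH) blast
    ultimately show ?case by (auto simp: Ck_on_Suc)
  }
qed

lemma has_partial_const: "has_partial b (\<lambda>z. c) 0 z"
  by (simp add: has_partial_def)

lemma has_partial_add:
  "has_partial b u D z \<Longrightarrow> has_partial b v E z \<Longrightarrow> has_partial b (\<lambda>z. u z + v z) (D + E) z"
  unfolding has_partial_def by (intro derivative_intros)

lemma has_partial_mult:
  "has_partial b u D z \<Longrightarrow> has_partial b v E z \<Longrightarrow>
    has_partial b (\<lambda>z. u z * v z) (D * v z + E * u z) z"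
  unfolding has_partial_def by (drule (1) DERIV_mult) simp

lemma has_partial_compose:
  assumes "has_partial b u D z" "(g has_real_derivative E) (at (u z))"
  shows "has_partial b (\<lambda>z. g (u z)) (E * D) z"
  unfolding has_partial_def
  by (rule DERIV_chain2[of g _ "\<lambda>t. u (z + t *\<^sub>R b)"])
    (use assms in \<open>auto simp: has_partial_def\<close>)

lemma Ck_on_const: "open G \<Longrightarrow> Ck_on k (\<lambda>z. c) G"
  by (induction k arbitrary: c) (auto intro!: Ck_on_SucI has_partial_const)

lemma Ck_on_add:
  assumes "open G" "Ck_on k u G" "Ck_on k v G"
  shows "Ck_on k (\<lambda>z. u z + v z) G"
  using assms(2,3)
proof (induction k arbitrary: u v)
  case (Suc k)
  show ?case
  proof (rule Ck_on_SucI[OF assms(1)])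
    show "continuous_on G (\<lambda>z. u z + v z)"
      using Suc.prems[THEN Ck_on_continuous] by (intro continuous_intros)
    show "has_partial b (\<lambda>z. u z + v z) (partial_deriv b u z + partial_deriv b v z) z"
      if "b \<in> Basis" "z \<in> G" for b z
      using Suc.prems[THEN Ck_on_has_partial[OF _ that]] by (rule has_partial_add)
    show "Ck_on k (\<lambda>z. partial_deriv b u z + partial_deriv b v z) G" if "b \<in> Basis" for b
      using Suc.prems[THEN Ck_on_partial[OF _ that]] by (rule Suc.IH)
  qed
qed (auto intro: continuous_intros)

lemma Ck_on_mult:
  assumes "open G" "Ck_on k u G" "Ck_on k v G"
  shows "Ck_on k (\<lambda>z. u z * v z) G"
  using assms(2,3)
proof (induction k arbitrary: u v)
  case (Suc k)
  show ?case
  proof (rule Ck_on_SucI[OF assms(1)])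
    show "continuous_on G (\<lambda>z. u z * v z)"
      using Suc.prems[THEN Ck_on_continuous] by (intro continuous_intros)
    show "has_partial b (\<lambda>z. u z * v z) (partial_deriv b u z * v z + partial_deriv b v z * u z) z"
      if "b \<in> Basis" "z \<in> G" for b z
      using Suc.prems[THEN Ck_on_has_partial[OF _ that]] by (rule has_partial_mult)
    show "Ck_on k (\<lambda>z. partial_deriv b u z * v z + partial_deriv b v z * u z) G"
      if "b \<in> Basis" for b
      using Suc.prems[THEN Ck_on_partial[OF _ that]] Suc.prems[THEN Ck_on_SucD]
      by (intro Ck_on_add assms Suc.IH)
  qed
qed (auto intro: continuous_intros)

lemma Ck_on_cmult: "open G \<Longrightarrow> Ck_on k u G \<Longrightarrow> Ck_on k (\<lambda>z. c * u z) G"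
  by (intro Ck_on_mult Ck_on_const)

lemma Ck_on_exp:
  assumes "open G" "Ck_on k u G"
  shows "Ck_on k (\<lambda>z. exp (u z)) G"
  using assms(2)
proof (induction k)
  case (Suc k)
  show ?case
  proof (rule Ck_on_SucI[OF assms(1)])
    show "continuous_on G (\<lambda>z. exp (u z))"
      using Suc.prems[THEN Ck_on_continuous] by (intro continuous_intros)
    show "has_partial b (\<lambda>z. exp (u z)) (exp (u z) * partial_deriv b u z) z"
      if "b \<in> Basis" "z \<in> G" for b z
      using Suc.prems[THEN Ck_on_has_partial[OF _ that]]
      by (rule has_partial_compose) (rule DERIV_exp)
    show "Ck_on k (\<lambda>z. exp (u z) * partial_deriv b u z) G" if "b \<in> Basis" for b
      using Suc.prems[THEN Ck_on_partial[OF _ that]] Suc.prems[THEN Ck_on_SucD]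
      by (intro Ck_on_mult assms Suc.IH)
  qed
qed (auto intro: continuous_intros)

lemma Ck_on_ln:
  assumes "open G" "Ck_on k u G" and pos: "\<And>z. z \<in> G \<Longrightarrow> u z > 0"
  shows "Ck_on k (\<lambda>z. ln (u z)) G"
  using assms(2)
proof (induction k)
  case 0
  then show ?case using pos by (auto intro!: continuous_intros simp: order_less_imp_not_eq2)
next
  case (Suc k)
  have ck: "Ck_on k u G" using Suc.prems by (rule Ck_on_SucD)
  show ?case
  proof (rule Ck_on_SucI[OF assms(1)])
    show "continuous_on G (\<lambda>z. ln (u z))"
      using Suc.prems[THEN Ck_on_continuous] pos by (auto intro!: continuous_intros simp: order_less_imp_not_eq2)
    \<comment> \<open>the reciprocal of \<open>u\<close> is written as \<open>exp (- ln u)\<close>, so that the induction hypothesis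
      provides its regularity\<close>
    show "has_partial b (\<lambda>z. ln (u z)) (exp (- 1 * ln (u z)) * partial_deriv b u z) z"
      if "b \<in> Basis" "z \<in> G" for b z
      using Suc.prems[THEN Ck_on_has_partial[OF _ that]]
      by (rule has_partial_compose)
        (use pos[OF that(2)] in \<open>auto intro!: derivative_eq_intros simp: exp_minus field_simps\<close>)
    show "Ck_on k (\<lambda>z. exp (- 1 * ln (u z)) * partial_deriv b u z) G" if "b \<in> Basis" for b
      using Suc.prems[THEN Ck_on_partial[OF _ that]]
      by (intro Ck_on_mult Ck_on_exp Ck_on_cmult assms Suc.IH ck)
  qed
qed

lemma has_partial_affine:
  assumes A: "\<And>t. A (z + t *\<^sub>R b) = A z + (s * t) *\<^sub>R d"
    and "has_partial d u D (A z)"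
  shows "has_partial b (\<lambda>z. u (A z)) (s * D) z"
proof -
  have "((\<lambda>t. u (A z + t *\<^sub>R d)) has_field_derivative D) (at (s * 0))"
    using assms(2) by (simp add: has_partial_def)
  moreover have "((\<lambda>t. s * t) has_field_derivative s) (at 0)"
    by (auto intro!: derivative_eq_intros)
  ultimately have "((\<lambda>t. u (A z + (s * t) *\<^sub>R d)) has_field_derivative D * s) (at 0)"
    by (rule DERIV_chain2)
  then show ?thesis by (simp add: has_partial_def A mult.commute)
qed

text \<open>The change of variables is any affine map that sends each coordinate axis to a coordinate
  axis: translations, and the reflections of the gradient estimate.\<close>

lemma Ck_on_affine:
  assumes "open G" "continuous_on UNIV A"
    and A: "\<And>b. b \<in> Basis \<Longrightarrow> d b \<in> Basis" "\<And>b z t. b \<in> Basis \<Longrightarrow> A (z + t *\<^sub>R b) = A z + (s b * t) *\<^sub>R d b"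
    and "Ck_on k u G"
  shows "Ck_on k (\<lambda>z. u (A z)) (A -` G)"
  using assms(5)
proof (induction k arbitrary: u)
  have cont: "continuous_on (A -` G) (\<lambda>z. u (A z))" if "continuous_on G u" for u :: "complex \<Rightarrow> real"
    using that continuous_on_subset[OF assms(2)] by (auto intro!: continuous_on_compose2[of G u])
  {
    case 0
    then show ?case using cont by simp
  next
    case (Suc k)
    show ?case
    proof (rule Ck_on_SucI)
      show "open (A -` G)" using open_vimage assms(1,2) by blast
      show "continuous_on (A -` G) (\<lambda>z. u (A z))" by (rule cont[OF Ck_on_continuous[OF Suc.prems]])
      show "has_partial b (\<lambda>z. u (A z)) (s b * partial_deriv (d b) u (A z)) z"
        if "b \<in> Basis" "z \<in> A -` G" for b z
        using that A Ck_on_has_partial[OF Suc.prems] by (intro has_partial_affine) auto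
      show "Ck_on k (\<lambda>z. s b * partial_deriv (d b) u (A z)) (A -` G)" if "b \<in> Basis" for b
        using open_vimage[OF assms(1,2)] Suc.IH[OF Ck_on_partial[OF Suc.prems A(1)[OF that]]]
        by (intro Ck_on_cmult)
    qed
  }
qed

definition has_laplacian :: "(complex \<Rightarrow> real) \<Rightarrow> (complex \<Rightarrow> real) \<Rightarrow> complex set \<Rightarrow> bool" where
  "has_laplacian u f G \<longleftrightarrow> open G \<and> Ck_on 2 u G \<and> (\<forall>z\<in>G. laplacian u z = f z)"

lemma laplacian_cong:
  assumes "open G" "z \<in> G" "\<And>w. w \<in> G \<Longrightarrow> u w = v w"
  shows "laplacian u z = laplacian v z"
proof -
  have "partial_deriv b (partial_deriv b u) z = partial_deriv b (partial_deriv b v) z" for b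
    by (rule partial_deriv_cong[OF assms(1,2)], rule partial_deriv_cong[OF assms(1)])
      (auto intro: assms(3))
  then show ?thesis by (simp add: laplacian_def)
qed

lemma has_laplacianI:
  assumes "open G" "continuous_on G u"
    and 1: "\<And>b z. b \<in> Basis \<Longrightarrow> z \<in> G \<Longrightarrow> has_partial b u (D b z) z"
    and 2: "\<And>b. b \<in> Basis \<Longrightarrow> Ck_on (Suc 0) (D b) G"
    and 3: "\<And>b z. b \<in> Basis \<Longrightarrow> z \<in> G \<Longrightarrow> has_partial b (D b) (E b z) z"
    and 4: "\<And>z. z \<in> G \<Longrightarrow> E 1 z + E \<i> z = f z"
  shows "has_laplacian u f G"
proof -
  have "partial_deriv b (partial_deriv b u) z = E b z" if "b \<in> Basis" "z \<in> G" for b z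
  proof -
    have "partial_deriv b (partial_deriv b u) z = partial_deriv b (D b) z"
      by (rule partial_deriv_cong[OF assms(1) that(2)]) (rule partial_deriv_eqI[OF 1[OF that(1)]])
    also have "\<dots> = E b z" by (rule partial_deriv_eqI[OF 3[OF that]])
    finally show ?thesis .
  qed
  then have "laplacian u z = f z" if "z \<in> G" for z
    using that by (simp add: laplacian_def 4 Basis_complex_def)
  then show ?thesis
    using Ck_on_SucI[OF assms(1,2) 1 2] assms(1) by (simp add: has_laplacian_def numeral_2_eq_2)
qed

lemma Ck_2_parts:
  assumes "Ck_on 2 u G" "b \<in> Basis"
  shows "Ck_on (Suc 0) (partial_deriv b u) G"
    and "z \<in> G \<Longrightarrow> has_partial b u (partial_deriv b u z) z"
    and "z \<in> G \<Longrightarrow> has_partial b (partial_deriv b u) (partial_deriv b (partial_deriv b u) z) z"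
proof -
  show ck: "Ck_on (Suc 0) (partial_deriv b u) G"
    using Ck_on_partial[OF _ assms(2), of "Suc 0" u G] assms by (simp add: numeral_2_eq_2)
  show "z \<in> G \<Longrightarrow> has_partial b u (partial_deriv b u z) z"
    using Ck_on_has_partial[OF _ assms(2), of "Suc 0" u G] assms by (simp add: numeral_2_eq_2)
  show "z \<in> G \<Longrightarrow> has_partial b (partial_deriv b u) (partial_deriv b (partial_deriv b u) z) z"
    by (rule Ck_on_has_partial[OF ck assms(2)])
qed

lemma has_laplacian_add:
  assumes "has_laplacian u f G" "has_laplacian v g G"
  shows "has_laplacian (\<lambda>z. u z + v z) (\<lambda>z. f z + g z) G"
proof -
  have G: "open G" and u: "Ck_on 2 u G" and v: "Ck_on 2 v G"
    using assms by (auto simp: has_laplacian_def)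
  show ?thesis
    by (rule has_laplacianI[where D="\<lambda>b z. partial_deriv b u z + partial_deriv b v z"
          and E="\<lambda>b z. partial_deriv b (partial_deriv b u) z + partial_deriv b (partial_deriv b v) z"])
      (use assms in \<open>auto intro!: G continuous_intros Ck_on_add has_partial_add Ck_on_continuous[OF u]
        Ck_on_continuous[OF v] Ck_2_parts[OF u] Ck_2_parts[OF v]
        simp: has_laplacian_def laplacian_def algebra_simps\<close>)
qed

lemma has_laplacian_cmult:
  assumes "has_laplacian u f G"
  shows "has_laplacian (\<lambda>z. c * u z) (\<lambda>z. c * f z) G"
proof -
  have G: "open G" and u: "Ck_on 2 u G"
    using assms by (auto simp: has_laplacian_def)
  have cm: "has_partial b (\<lambda>z. c * u z) (c * D) z" if "has_partial b u D z" for b u D z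
    using has_partial_mult[OF has_partial_const that, of c] by (simp add: mult.commute)
  show ?thesis
    by (rule has_laplacianI[where D="\<lambda>b z. c * partial_deriv b u z"
          and E="\<lambda>b z. c * partial_deriv b (partial_deriv b u) z"])
      (use assms in \<open>auto intro!: G continuous_intros Ck_on_cmult cm Ck_on_continuous[OF u]
        Ck_2_parts[OF u]
        simp: has_laplacian_def laplacian_def simp flip: distrib_left\<close>)
qed

lemma has_laplacian_diff:
  assumes "has_laplacian u f G" "has_laplacian v g G"
  shows "has_laplacian (\<lambda>z. u z - v z) (\<lambda>z. f z - g z) G"
  using has_laplacian_add[OF assms(1) has_laplacian_cmult[OF assms(2), of "-1"]] by simp

lemma has_laplacian_subset: "has_laplacian u f G \<Longrightarrow> open H \<Longrightarrow> H \<subseteq> G \<Longrightarrow> has_laplacian u f H"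
  by (auto simp: has_laplacian_def intro: Ck_on_mono)

text \<open>The signs \<open>s b\<close> disappear from the Laplacian because each second derivative picks up
  \<open>(s b)\<^sup>2 = 1\<close>.\<close>

lemma has_laplacian_affine:
  assumes "has_laplacian u f G" "continuous_on UNIV A"
    and A: "\<And>b. b \<in> Basis \<Longrightarrow> d b \<in> Basis" "d 1 \<noteq> d \<i>"
      "\<And>b z t. b \<in> Basis \<Longrightarrow> A (z + t *\<^sub>R b) = A z + (s b * t) *\<^sub>R d b"
      "\<And>b. b \<in> Basis \<Longrightarrow> (s b)\<^sup>2 = 1"
  shows "has_laplacian (\<lambda>z. u (A z)) (\<lambda>z. f (A z)) (A -` G)"
proof -
  have G: "open G" and u: "Ck_on 2 u G" and lap: "\<And>z. z \<in> G \<Longrightarrow> laplacian u z = f z"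
    using assms by (auto simp: has_laplacian_def)
  have o: "open (A -` G)" by (rule open_vimage[OF G assms(2)])
  have d: "(d 1 = 1 \<and> d \<i> = \<i>) \<or> (d 1 = \<i> \<and> d \<i> = 1)"
    using A(1)[of 1] A(1)[of \<i>] A(2) by (auto simp: Basis_complex_def)
  have Ck: "Ck_on k (\<lambda>z. w (A z)) (A -` G)" if "Ck_on k w G" for w k
    by (rule Ck_on_affine[OF G assms(2) A(1,3) that])
  show ?thesis
  proof (rule has_laplacianI[where D="\<lambda>b z. s b * partial_deriv (d b) u (A z)"
          and E="\<lambda>b z. s b * (s b * partial_deriv (d b) (partial_deriv (d b) u) (A z))"])
    show "continuous_on (A -` G) (\<lambda>z. u (A z))"
      using Ck[OF u] by (rule Ck_on_continuous)
    fix b :: complex assume b: "b \<in> Basis"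
    show "Ck_on (Suc 0) (\<lambda>z. s b * partial_deriv (d b) u (A z)) (A -` G)"
      by (intro Ck_on_cmult o Ck Ck_2_parts u A b)
    fix z assume z: "z \<in> A -` G"
    show "has_partial b (\<lambda>z. u (A z)) (s b * partial_deriv (d b) u (A z)) z"
      using b z by (intro has_partial_affine[where d="d b"] A Ck_2_parts[OF u]) auto
    have "has_partial b (\<lambda>z. partial_deriv (d b) u (A z))
      (s b * partial_deriv (d b) (partial_deriv (d b) u) (A z)) z"
      using b z by (intro has_partial_affine[where d="d b"] A Ck_2_parts[OF u]) auto
    from has_partial_mult[OF has_partial_const this, of "s b"]
    show "has_partial b (\<lambda>z. s b * partial_deriv (d b) u (A z))
       (s b * (s b * partial_deriv (d b) (partial_deriv (d b) u) (A z))) z"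
      by (simp add: mult.commute)
  next
    fix z assume "z \<in> A -` G"
    then show "s 1 * (s 1 * partial_deriv (d 1) (partial_deriv (d 1) u) (A z)) +
         s \<i> * (s \<i> * partial_deriv (d \<i>) (partial_deriv (d \<i>) u) (A z)) = f (A z)"
      using A(4)[of 1] A(4)[of \<i>] d lap[of "A z"]
      by (auto simp: power2_eq_square laplacian_def Basis_complex_def simp flip: mult.assoc)
  qed (rule o)
qed

lemma has_laplacian_translate:
  assumes "has_laplacian u f G"
  shows "has_laplacian (\<lambda>z. u (z + h)) (\<lambda>z. f (z + h)) ((\<lambda>z. z + h) -` G)"
  by (rule has_laplacian_affine[OF assms, where d="\<lambda>b. b" and s="\<lambda>b. 1"])
    (auto intro!: continuous_intros)

section \<open>Uniform limits of classical solutions and the maximum principle\<close>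

lemma continuous_on_has_laplacian:
  assumes "has_laplacian u f G"
  shows "continuous_on G u" "continuous_on G f"
proof -
  have u: "Ck_on 2 u G" and lap: "\<And>z. z \<in> G \<Longrightarrow> laplacian u z = f z"
    using assms by (auto simp: has_laplacian_def)
  show "continuous_on G u" using u by (rule Ck_on_continuous)
  have "continuous_on G (partial_deriv b (partial_deriv b u))" if "b \<in> Basis" for b
    using Ck_on_partial[OF Ck_2_parts(1)[OF u that] that] by simp
  then have "continuous_on G (laplacian u)"
    unfolding laplacian_def[abs_def] by (intro continuous_intros) (auto simp: Basis_complex_def)
  then show "continuous_on G f" using lap by (simp cong: continuous_on_cong)
qed

lemma continuous_on_approx:
  fixes u :: "'a::topological_space \<Rightarrow> real"
  assumes "\<And>e. e > 0 \<Longrightarrow> \<exists>v. continuous_on S v \<and> (\<forall>z\<in>S. \<bar>v z - u z\<bar> < e)"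
  shows "continuous_on S u"
proof -
  have "\<exists>v. continuous_on S v \<and> (\<forall>z\<in>S. \<bar>v z - u z\<bar> < inverse (real (Suc n)))" for n
    by (rule assms) simp
  then obtain v where v: "\<And>n. continuous_on S (v n)"
      "\<And>n z. z \<in> S \<Longrightarrow> \<bar>v n z - u z\<bar> < inverse (real (Suc n))"
    by metis
  have "uniform_limit S v u sequentially"
  proof (rule uniform_limitI)
    fix e :: real assume "e > 0"
    then obtain N where N: "inverse (real (Suc N)) < e" using reals_Archimedean by blast
    have "\<forall>z\<in>S. dist (v n z) (u z) < e" if "n \<ge> N" for n
    proof
      fix z assume "z \<in> S"
      have "inverse (real (Suc n)) \<le> inverse (real (Suc N))" using that by (simp add: field_simps)
      then show "dist (v n z) (u z) < e"
        using v(2)[OF \<open>z \<in> S\<close>, of n] N unfolding dist_real_def by linarith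
    qed
    then show "\<forall>\<^sub>F n in sequentially. \<forall>z\<in>S. dist (v n z) (u z) < e"
      by (auto simp: eventually_sequentially)
  qed
  then show ?thesis
    by (rule uniform_limit_theorem[rotated]) (simp_all add: v(1))
qed

text \<open>Solutions of \<open>\<Delta>u = f\<close> in the sense of uniform approximation by classical solutions. The class of
  such pairs is linear, translation invariant and closed under uniform limits, so solutions can be
  constructed as limits of sequences and of difference quotients without control of second
  derivatives; the maximum principle still holds, and regularity is recovered afterwards.\<close>

definition weak_laplacian :: "(complex \<Rightarrow> real) \<Rightarrow> (complex \<Rightarrow> real) \<Rightarrow> complex set \<Rightarrow> bool" where
  "weak_laplacian u f G \<longleftrightarrow> open G \<and>
     (\<forall>e>0. \<exists>v g. has_laplacian v g G \<and> (\<forall>z\<in>G. \<bar>v z - u z\<bar> < e \<and> \<bar>g z - f z\<bar> < e))"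

lemma weak_laplacianD:
  assumes "weak_laplacian u f G" "e > 0"
  obtains v g where "has_laplacian v g G" "\<And>z. z \<in> G \<Longrightarrow> \<bar>v z - u z\<bar> < e"
    "\<And>z. z \<in> G \<Longrightarrow> \<bar>g z - f z\<bar> < e"
  using assms unfolding weak_laplacian_def by blast

lemma weak_laplacian_classical: "has_laplacian u f G \<Longrightarrow> weak_laplacian u f G"
  unfolding weak_laplacian_def has_laplacian_def by force

lemma weak_laplacian_cong:
  assumes "weak_laplacian u f G" "\<And>z. z \<in> G \<Longrightarrow> u z = u' z" "\<And>z. z \<in> G \<Longrightarrow> f z = f' z"
  shows "weak_laplacian u' f' G"
  using assms unfolding weak_laplacian_def by (metis (no_types, lifting))

lemma weak_laplacian_subset:
  assumes "weak_laplacian u f G" "open H" "H \<subseteq> G"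
  shows "weak_laplacian u f H"
  using assms has_laplacian_subset[OF _ assms(2,3)] unfolding weak_laplacian_def by (meson subsetD)

lemma weak_laplacian_limit:
  assumes "open G"
    and "\<And>e. e > 0 \<Longrightarrow> \<exists>v g. weak_laplacian v g G \<and> (\<forall>z\<in>G. \<bar>v z - u z\<bar> < e \<and> \<bar>g z - f z\<bar> < e)"
  shows "weak_laplacian u f G"
  unfolding weak_laplacian_def
proof (intro conjI allI impI)
  fix e :: real assume "e > 0"
  then obtain v g where v: "weak_laplacian v g G" "\<forall>z\<in>G. \<bar>v z - u z\<bar> < e/2 \<and> \<bar>g z - f z\<bar> < e/2"
    using assms(2)[of "e/2"] by auto
  obtain v' g' where v': "has_laplacian v' g' G" "\<And>z. z \<in> G \<Longrightarrow> \<bar>v' z - v z\<bar> < e/2"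
    "\<And>z. z \<in> G \<Longrightarrow> \<bar>g' z - g z\<bar> < e/2"
    using weak_laplacianD[OF v(1), of "e/2"] \<open>e > 0\<close> by auto
  have "\<bar>v' z - u z\<bar> < e \<and> \<bar>g' z - f z\<bar> < e" if "z \<in> G" for z
    using v(2)[rule_format, OF that] v'(2,3)[OF that] by linarith
  then show "\<exists>v g. has_laplacian v g G \<and> (\<forall>z\<in>G. \<bar>v z - u z\<bar> < e \<and> \<bar>g z - f z\<bar> < e)"
    using v'(1) by blast
qed (rule assms(1))

lemma weak_laplacian_add:
  assumes "weak_laplacian u f G" "weak_laplacian v g G"
  shows "weak_laplacian (\<lambda>z. u z + v z) (\<lambda>z. f z + g z) G"
proof (rule weak_laplacian_limit)
  show "open G" using assms(1) by (simp add: weak_laplacian_def)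
  fix e :: real assume e: "e > 0"
  obtain u' f' where 1: "has_laplacian u' f' G" "\<And>z. z \<in> G \<Longrightarrow> \<bar>u' z - u z\<bar> < e/2"
    "\<And>z. z \<in> G \<Longrightarrow> \<bar>f' z - f z\<bar> < e/2"
    using weak_laplacianD[OF assms(1), of "e/2"] e by auto
  obtain v' g' where 2: "has_laplacian v' g' G" "\<And>z. z \<in> G \<Longrightarrow> \<bar>v' z - v z\<bar> < e/2"
    "\<And>z. z \<in> G \<Longrightarrow> \<bar>g' z - g z\<bar> < e/2"
    using weak_laplacianD[OF assms(2), of "e/2"] e by auto
  have "\<bar>u' z + v' z - (u z + v z)\<bar> < e \<and> \<bar>f' z + g' z - (f z + g z)\<bar> < e" if "z \<in> G" for z
    using 1(2,3)[OF that] 2(2,3)[OF that] by linarith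
  then show "\<exists>w h. weak_laplacian w h G \<and>
      (\<forall>z\<in>G. \<bar>w z - (u z + v z)\<bar> < e \<and> \<bar>h z - (f z + g z)\<bar> < e)"
    using weak_laplacian_classical[OF has_laplacian_add[OF 1(1) 2(1)]] by (intro exI conjI) auto
qed

lemma weak_laplacian_cmult:
  assumes "weak_laplacian u f G"
  shows "weak_laplacian (\<lambda>z. c * u z) (\<lambda>z. c * f z) G"
proof (rule weak_laplacian_limit)
  show "open G" using assms(1) by (simp add: weak_laplacian_def)
  fix e :: real assume e: "e > 0"
  obtain u' f' where 1: "has_laplacian u' f' G" "\<And>z. z \<in> G \<Longrightarrow> \<bar>u' z - u z\<bar> < e/(\<bar>c\<bar>+1)"
    "\<And>z. z \<in> G \<Longrightarrow> \<bar>f' z - f z\<bar> < e/(\<bar>c\<bar>+1)"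
    using weak_laplacianD[OF assms(1), of "e/(\<bar>c\<bar>+1)"] e by auto
  have scale: "\<bar>c * x - c * y\<bar> < e" if "\<bar>x - y\<bar> < e/(\<bar>c\<bar>+1)" for x y
  proof -
    have "\<bar>c * x - c * y\<bar> = \<bar>c\<bar> * \<bar>x - y\<bar>" by (simp add: abs_mult flip: right_diff_distrib)
    also have "\<dots> \<le> (\<bar>c\<bar>+1) * \<bar>x - y\<bar>" by (simp add: mult_right_mono)
    also have "\<dots> < e" using that by (simp add: field_simps)
    finally show ?thesis .
  qed
  show "\<exists>w h. weak_laplacian w h G \<and> (\<forall>z\<in>G. \<bar>w z - c * u z\<bar> < e \<and> \<bar>h z - c * f z\<bar> < e)"
    using weak_laplacian_classical[OF has_laplacian_cmult[OF 1(1)]] 1(2,3)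
    by (intro exI conjI) (auto intro: scale)
qed

lemma weak_laplacian_diff:
  assumes "weak_laplacian u f G" "weak_laplacian v g G"
  shows "weak_laplacian (\<lambda>z. u z - v z) (\<lambda>z. f z - g z) G"
  using weak_laplacian_add[OF assms(1) weak_laplacian_cmult[OF assms(2), of "-1"]] by simp

lemma weak_laplacian_translate:
  assumes "weak_laplacian u f G"
  shows "weak_laplacian (\<lambda>z. u (z + h)) (\<lambda>z. f (z + h)) ((\<lambda>z. z + h) -` G)"
proof (rule weak_laplacian_limit)
  show "open ((\<lambda>z. z + h) -` G)"
    using assms by (intro open_vimage continuous_intros) (simp add: weak_laplacian_def)
  fix e :: real assume "e > 0"
  then obtain v g where "has_laplacian v g G" "\<And>z. z \<in> G \<Longrightarrow> \<bar>v z - u z\<bar> < e"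
    "\<And>z. z \<in> G \<Longrightarrow> \<bar>g z - f z\<bar> < e"
    using weak_laplacianD[OF assms] by blast
  then show "\<exists>v g. weak_laplacian v g ((\<lambda>z. z + h) -` G) \<and> (\<forall>z\<in>(\<lambda>z. z + h) -` G.
      \<bar>v z - u (z + h)\<bar> < e \<and> \<bar>g z - f (z + h)\<bar> < e)"
    using weak_laplacian_classical[OF has_laplacian_translate] by (intro exI conjI) auto
qed

lemma continuous_on_weak_laplacian:
  assumes "weak_laplacian u f G"
  shows "continuous_on G u" "continuous_on G f"
  by (rule continuous_on_approx,
      metis weak_laplacianD[OF assms] continuous_on_has_laplacian)+

lemma second_derivative_at_max:
  fixes f f' :: "real \<Rightarrow> real"
  assumes "d > 0" and f: "\<And>t. \<bar>t\<bar> < d \<Longrightarrow> (f has_real_derivative f' t) (at t)"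
    and f': "(f' has_real_derivative D) (at 0)" and max: "\<And>t. \<bar>t\<bar> < d \<Longrightarrow> f t \<le> f 0"
  shows "D \<le> 0"
proof (rule ccontr)
  assume "\<not> D \<le> 0"
  then obtain e where e: "e > 0" "\<And>h. 0 < h \<Longrightarrow> h < e \<Longrightarrow> f' 0 < f' h"
    using DERIV_pos_inc_right[OF f'] by auto
  have f'0: "f' 0 = 0"
    using f[of 0] \<open>d > 0\<close> max by (intro DERIV_local_max[of f _ 0 d]) auto
  define t where "t = min d e / 2"
  have t: "0 < t" "t < d" "t < e" using e \<open>d > 0\<close> by (auto simp: t_def min_def)
  obtain z where z: "0 < z" "z < t" "f t - f 0 = (t - 0) * f' z"
    using MVT2[OF t(1), of f f'] f t by (metis abs_of_nonneg order_le_less_trans)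
  then have "f t - f 0 > 0" using e(2)[of z] t f'0 by simp
  then show False using max[of t] t by simp
qed

lemma laplacian_at_max:
  assumes "has_laplacian u f G" "z \<in> G" and max: "\<And>w. w \<in> G \<Longrightarrow> u w \<le> u z"
  shows "f z \<le> 0"
proof -
  have G: "open G" and u: "Ck_on 2 u G" and lap: "laplacian u z = f z"
    using assms by (auto simp: has_laplacian_def)
  have "partial_deriv b (partial_deriv b u) z \<le> 0" if b: "b \<in> Basis" for b
  proof -
    obtain d where d: "d > 0" "\<And>t. \<bar>t\<bar> < d \<Longrightarrow> z + t *\<^sub>R b \<in> G"
      using eventually_on_line[OF G \<open>z \<in> G\<close>, of b] by (auto simp: eventually_nhds_metric dist_real_def)
    show ?thesis
    proof (rule second_derivative_at_max[OF d(1)])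
      show "((\<lambda>t. u (z + t *\<^sub>R b)) has_real_derivative partial_deriv b u (z + t *\<^sub>R b)) (at t)"
        if "\<bar>t\<bar> < d" for t
        by (intro has_partial_along_line Ck_2_parts[OF u b] d that)
      show "((\<lambda>t. partial_deriv b u (z + t *\<^sub>R b)) has_real_derivative
          partial_deriv b (partial_deriv b u) z) (at 0)"
        using Ck_2_parts(3)[OF u b \<open>z \<in> G\<close>] by (simp add: has_partial_def)
    qed (use max d(2) in auto)
  qed
  from this[of 1] this[of \<i>] show ?thesis
    using lap by (simp add: laplacian_def Basis_complex_def)
qed

lemma has_laplacian_quadratic:
  "has_laplacian (\<lambda>z. p * (Re z)\<^sup>2 + q * (Im z)\<^sup>2 + a * Re z + b * Im z + k) (\<lambda>z. 2 * p + 2 * q) UNIV"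
proof -
  let ?D = "\<lambda>(d::complex) z. if d = 1 then 2 * p * Re z + a else 2 * q * Im z + b"
  let ?E = "\<lambda>d::complex. if d = 1 then 2 * p else 2 * q"
  have ck: "Ck_on (Suc 0) (?D d) UNIV" if "d \<in> Basis" for d
    by (rule Ck_on_SucI[where D="\<lambda>d' z. if d' = d then ?E d else 0"])
      (use that in \<open>auto intro!: continuous_intros derivative_eq_intros
        simp: has_partial_def Basis_complex_def\<close>)
  show ?thesis
    by (rule has_laplacianI[where D="?D" and E="\<lambda>d z. ?E d"], simp, force intro!: continuous_intros)
      (use ck in \<open>auto intro!: continuous_intros derivative_eq_intros
        simp: has_partial_def Basis_complex_def algebra_simps power2_eq_square\<close>)
qed

lemma has_laplacian_square_dist:
  "has_laplacian (\<lambda>z. s * (dist c z)\<^sup>2 + k) (\<lambda>z. 4 * s) UNIV"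
proof -
  have "s * (dist c z)\<^sup>2 + k = s * (Re z)\<^sup>2 + s * (Im z)\<^sup>2 + (- 2 * s * Re c) * Re z +
      (- 2 * s * Im c) * Im z + (s * (Re c)\<^sup>2 + s * (Im c)\<^sup>2 + k)" for z
    unfolding dist_norm cmod_power2 by (simp add: power2_eq_square algebra_simps)
  then have eq: "(\<lambda>z. s * (dist c z)\<^sup>2 + k) = (\<lambda>z. s * (Re z)\<^sup>2 + s * (Im z)\<^sup>2 +
      (- 2 * s * Re c) * Re z + (- 2 * s * Im c) * Im z + (s * (Re c)\<^sup>2 + s * (Im c)\<^sup>2 + k))"
    by (rule ext)
  show ?thesis
    unfolding eq using has_laplacian_quadratic[of s s "- 2 * s * Re c" "- 2 * s * Im c"
        "s * (Re c)\<^sup>2 + s * (Im c)\<^sup>2 + k"] by simp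
qed

text \<open>A maximum of \<open>u\<close> need not be a maximum of a classical approximant \<open>v\<close>. Subtracting a small
  multiple of \<open>(dist z x)\<^sup>2\<close> lowers \<open>v\<close> by a definite amount on a sphere around \<open>z\<close>, which forces
  an interior maximum of the difference once \<open>v\<close> is close enough to \<open>u\<close>; if \<open>f z > 0\<close>, then the
  Laplacian there is still positive.\<close>

lemma weak_laplacian_at_max:
  assumes "weak_laplacian u f G" "z \<in> G" and max: "\<And>w. w \<in> G \<Longrightarrow> u w \<le> u z"
  shows "f z \<le> 0"
proof (rule ccontr)
  assume "\<not> f z \<le> 0"
  define e where "e = f z / 2"
  have e: "e > 0" "f z > e" using \<open>\<not> f z \<le> 0\<close> by (auto simp: e_def)
  have G: "open G" using assms(1) by (simp add: weak_laplacian_def)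
  have "open {w \<in> G. f w > e}"
    using continuous_on_weak_laplacian(2)[OF assms(1)]
      continuous_open_preimage[OF _ G open_greaterThan[of e]]
    by (simp add: vimage_def Int_def)
  moreover have "z \<in> {w \<in> G. f w > e}" using assms(2) e by simp
  ultimately obtain \<rho> where \<rho>: "\<rho> > 0" "cball z \<rho> \<subseteq> {w \<in> G. f w > e}"
    by (meson open_contains_cball)
  define s where "s = e / 16"
  define \<eta> where "\<eta> = min (e/2) (s * \<rho>\<^sup>2 / 2)"
  have "\<eta> > 0" using e \<rho> by (simp add: \<eta>_def s_def)
  then obtain v g where v: "has_laplacian v g G" "\<And>z. z \<in> G \<Longrightarrow> \<bar>v z - u z\<bar> < \<eta>"
    "\<And>z. z \<in> G \<Longrightarrow> \<bar>g z - f z\<bar> < \<eta>"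
    using weak_laplacianD[OF assms(1)] by blast
  \<comment> \<open>\<open>w\<close> has Laplacian close to \<open>f - e / 4 > 0\<close>, while the quadratic term exceeds the error \<open>2 * \<eta>\<close> of
    the approximation on the sphere of radius \<open>\<rho>\<close>\<close>
  define w where "w = (\<lambda>x. v x - (s * (dist z x)\<^sup>2 + 0))"
  have w: "has_laplacian w (\<lambda>x. g x - 4 * s) G"
    unfolding w_def
    by (intro has_laplacian_diff v(1) has_laplacian_subset[OF has_laplacian_square_dist] G) simp
  have "continuous_on (cball z \<rho>) w"
    using continuous_on_has_laplacian(1)[OF w] \<rho>(2) by (auto intro: continuous_on_subset)
  then obtain x where x: "x \<in> cball z \<rho>" "\<And>y. y \<in> cball z \<rho> \<Longrightarrow> w y \<le> w x"
    using continuous_attains_sup[of "cball z \<rho>" w] \<rho>(1) by auto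
  have xG: "x \<in> G" "f x > e" using x(1) \<rho>(2) by auto
  show False
  proof (cases "x \<in> ball z \<rho>")
    case True
    have "ball z \<rho> \<subseteq> G" using \<rho>(2) ball_subset_cball[of z \<rho>] by blast
    then have "g x - 4 * s \<le> 0"
      using laplacian_at_max[OF has_laplacian_subset[OF w open_ball] True] x(2) by auto
    moreover have "\<eta> \<le> e / 2" "4 * s = e / 4" by (simp_all add: \<eta>_def s_def)
    ultimately show False using v(3)[OF xG(1)] xG(2) e(1) by linarith
  next
    case False
    then have "dist z x = \<rho>" using x(1) by simp
    then have "w x = v x - s * \<rho>\<^sup>2" by (simp add: w_def)
    moreover have "w z = v z" by (simp add: w_def)
    moreover have "w z \<le> w x" using x(2)[of z] \<rho>(1) by simp
    moreover have "2 * \<eta> \<le> s * \<rho>\<^sup>2" by (simp add: \<eta>_def)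
    ultimately show False
      using v(2)[OF xG(1)] v(2)[OF assms(2)] max[OF xG(1)] by linarith
  qed
qed

text \<open>Positivity of \<open>f\<close> is asked only where \<open>u\<close> itself is positive. For a difference \<open>u = u\<^sub>1 - u\<^sub>2\<close> of
  solutions of \<open>\<Delta>u = F(u)\<close> this is where monotonicity of \<open>F\<close> gives a sign.\<close>

lemma maximum_principle:
  assumes "compact C" "G \<subseteq> C" "continuous_on C u" "weak_laplacian u f G"
    and pos: "\<And>z. z \<in> G \<Longrightarrow> u z > 0 \<Longrightarrow> f z > 0"
    and bdry: "\<And>z. z \<in> C - G \<Longrightarrow> u z \<le> 0"
    and "z \<in> C"
  shows "u z \<le> 0"
proof -
  obtain x where x: "x \<in> C" "\<And>y. y \<in> C \<Longrightarrow> u y \<le> u x"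
    using continuous_attains_sup[OF assms(1) _ assms(3)] \<open>z \<in> C\<close> by auto
  have "u x \<le> 0"
  proof (rule ccontr)
    assume "\<not> u x \<le> 0"
    with x bdry have "x \<in> G" by force
    then show False
      using weak_laplacian_at_max[OF assms(4) \<open>x \<in> G\<close>] x assms(2) pos[of x] \<open>\<not> u x \<le> 0\<close> by force
  qed
  then show ?thesis using x(2)[OF \<open>z \<in> C\<close>] by simp
qed

text \<open>Comparison with the paraboloid \<open>\<alpha> + s (r\<^sup>2 - \<bar>z - c\<bar>\<^sup>2) / 4\<close>, which has Laplacian \<open>- s\<close>, boundary
  values \<open>\<alpha>\<close> and maximum \<open>\<alpha> + s r\<^sup>2 / 4\<close>.\<close>

lemma disk_upper_bound:
  assumes "r > 0" "continuous_on (cball c r) w" "weak_laplacian w f (ball c r)"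
    and bdry: "\<And>z. z \<in> sphere c r \<Longrightarrow> w z \<le> \<alpha>" and "s \<ge> 0"
    and lower: "\<And>z. z \<in> ball c r \<Longrightarrow> w z > \<alpha> \<Longrightarrow> f z > - s"
    and "z \<in> cball c r"
  shows "w z \<le> \<alpha> + s * r\<^sup>2 / 4"
proof -
  let ?h = "\<lambda>z. (- s / 4) * (dist c z)\<^sup>2 + (\<alpha> + s * r\<^sup>2 / 4)"
  have h: "?h z \<ge> \<alpha>" if "z \<in> cball c r" for z
  proof -
    have "(dist c z)\<^sup>2 \<le> r\<^sup>2" using that by (simp add: power_mono)
    then have "s * (dist c z)\<^sup>2 \<le> s * r\<^sup>2" using \<open>s \<ge> 0\<close> by (rule mult_left_mono)
    then show ?thesis by simp
  qed
  have "w z - ?h z \<le> 0"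
  proof (rule maximum_principle[of "cball c r" "ball c r" _ "\<lambda>z. f z - 4 * (- s / 4)"])
    show "continuous_on (cball c r) (\<lambda>z. w z - ?h z)" by (intro continuous_intros assms(2))
    show "weak_laplacian (\<lambda>z. w z - ?h z) (\<lambda>z. f z - 4 * (- s / 4)) (ball c r)"
      by (intro weak_laplacian_diff assms(3) weak_laplacian_classical
          has_laplacian_subset[OF has_laplacian_square_dist]) auto
    show "f z - 4 * (- s / 4) > 0" if "z \<in> ball c r" "w z - ?h z > 0" for z
      using lower[OF that(1)] h[of z] that by auto
    show "w z - ?h z \<le> 0" if "z \<in> cball c r - ball c r" for z
      using bdry[of z] that by auto
  qed (use \<open>z \<in> cball c r\<close> in auto)
  moreover have "s * (dist c z)\<^sup>2 \<ge> 0" using \<open>s \<ge> 0\<close> by simp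
  ultimately show ?thesis by simp
qed

section \<open>The linear Dirichlet problem on a disk\<close>

text \<open>In the normalized coordinate \<open>\<zeta> = (z - c) / r\<close> the Laplacian is a multiple of
  the product of the two Wirtinger derivatives. It maps monomials in \<open>\<zeta>\<close> and \<open>cnj \<zeta>\<close> to monomials
  and is inverted by raising both exponents; on the circle, \<open>\<zeta> * cnj \<zeta> = 1\<close> reduces every monomial
  to a harmonic one. This solves the Dirichlet problem for polynomial data explicitly.\<close>

definition disk_monomial :: "complex \<Rightarrow> real \<Rightarrow> complex \<Rightarrow> nat \<Rightarrow> nat \<Rightarrow> complex \<Rightarrow> real" where
  "disk_monomial c r k m n z =
     Re (k * ((z - c) / of_real r) ^ m * cnj ((z - c) / of_real r) ^ n)"

lemma has_partial_disk_monomial: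
  fixes b :: complex and r :: real
  defines "\<beta> \<equiv> b / of_real r"
  shows "has_partial b (disk_monomial c r k m n)
    (disk_monomial c r (k * of_nat m * \<beta>) (m - 1) n z +
     disk_monomial c r (k * of_nat n * cnj \<beta>) m (n - 1) z) z"
proof -
  let ?\<zeta> = "(z - c) / of_real r"
  let ?H = "\<lambda>w. k * (?\<zeta> + w * \<beta>) ^ m * (cnj ?\<zeta> + w * cnj \<beta>) ^ n"
  let ?D = "k * of_nat m * \<beta> * ?\<zeta> ^ (m - 1) * cnj ?\<zeta> ^ n +
     k * of_nat n * cnj \<beta> * ?\<zeta> ^ m * cnj ?\<zeta> ^ (n - 1)"
  have "(?H has_field_derivative ?D) (at (of_real 0))"
    by (auto intro!: derivative_eq_intros simp: algebra_simps)
  then have "((\<lambda>t. ?H (of_real t)) has_vector_derivative ?D) (at 0)"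
    by (rule has_vector_derivative_real_field)
  then have "((\<lambda>t. Re (?H (of_real t))) has_vector_derivative Re ?D) (at 0)"
    by (rule bounded_linear.has_vector_derivative[OF bounded_linear_Re])
  moreover have "Re (?H (of_real t)) = disk_monomial c r k m n (z + t *\<^sub>R b)" for t
  proof -
    have "(z + t *\<^sub>R b - c) / of_real r = ?\<zeta> + of_real t * \<beta>"
      by (simp add: \<beta>_def scaleR_conv_of_real diff_divide_distrib add_divide_distrib)
    then show ?thesis by (simp add: disk_monomial_def)
  qed
  ultimately show ?thesis
    by (simp add: has_partial_def has_real_derivative_iff_has_vector_derivative disk_monomial_def)
qed

lemma continuous_on_disk_monomial: "continuous_on S (disk_monomial c r k m n)"
  unfolding disk_monomial_def[abs_def] divide_inverse by (intro continuous_intros)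

lemma Ck_on_disk_monomial: "Ck_on j (disk_monomial c r k m n) UNIV"
proof (induction j arbitrary: k m n)
  case (Suc j)
  show ?case
    by (rule Ck_on_SucI[OF open_UNIV continuous_on_disk_monomial has_partial_disk_monomial])
      (intro Ck_on_add open_UNIV Suc)
qed (simp add: continuous_on_disk_monomial)

text \<open>The terms with second powers of \<open>b / r\<close> cancel between \<open>b = 1\<close> and \<open>b = \<i>\<close>, and the mixed terms
  with \<open>\<bar>b / r\<bar>\<^sup>2\<close> add up. When an exponent is zero, its coefficient vanishes and the truncated
  subtraction does no harm.\<close>

lemma has_laplacian_disk_monomial:
  assumes "r > 0"
  shows "has_laplacian (disk_monomial c r k m n)
    (disk_monomial c r (4 * of_nat m * of_nat n * k / (of_real r)\<^sup>2) (m - 1) (n - 1)) UNIV"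
proof -
  let ?\<beta> = "\<lambda>b. b / complex_of_real r"
  let ?D = "\<lambda>b z. disk_monomial c r (k * of_nat m * ?\<beta> b) (m - 1) n z +
      disk_monomial c r (k * of_nat n * cnj (?\<beta> b)) m (n - 1) z"
  let ?E = "\<lambda>b z.
     (disk_monomial c r (k * of_nat m * ?\<beta> b * of_nat (m - 1) * ?\<beta> b) (m - 1 - 1) n z +
      disk_monomial c r (k * of_nat m * ?\<beta> b * of_nat n * cnj (?\<beta> b)) (m - 1) (n - 1) z) +
     (disk_monomial c r (k * of_nat n * cnj (?\<beta> b) * of_nat m * ?\<beta> b) (m - 1) (n - 1) z +
      disk_monomial c r (k * of_nat n * cnj (?\<beta> b) * of_nat (n - 1) * cnj (?\<beta> b)) m (n - 1 - 1) z)"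
  have "?E 1 z + ?E \<i> z =
      disk_monomial c r (4 * of_nat m * of_nat n * k / (of_real r)\<^sup>2) (m - 1) (n - 1) z" for z
  proof -
    define P where "P = ((z - c) / of_real r) ^ (m - 1 - 1) * cnj ((z - c) / of_real r) ^ n"
  define Q where "Q = ((z - c) / of_real r) ^ (m - 1) * cnj ((z - c) / of_real r) ^ (n - 1)"
  define R where "R = ((z - c) / of_real r) ^ m * cnj ((z - c) / of_real r) ^ (n - 1 - 1)"
  have m: "disk_monomial c r K (m - 1 - 1) n z = Re (K * P)"
    "disk_monomial c r K (m - 1) (n - 1) z = Re (K * Q)"
    "disk_monomial c r K m (n - 1 - 1) z = Re (K * R)" for K
    by (simp_all only: disk_monomial_def P_def Q_def R_def mult.assoc)
  show ?thesis
    unfolding m plus_complex.sel[symmetric]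
    using assms by (intro arg_cong[where f=Re]) (simp add: field_simps power2_eq_square)
  qed
  then show ?thesis
    by (intro has_laplacianI[where D="?D" and E="?E"] open_UNIV continuous_on_disk_monomial
        has_partial_add has_partial_disk_monomial Ck_on_add Ck_on_disk_monomial)
qed

text \<open>The inverse Laplacian and the harmonic extension are additive, so they are needed only on monomials.
  Their sums are exactly the real polynomial functions of the plane.\<close>

inductive disk_polynomial :: "complex \<Rightarrow> real \<Rightarrow> (complex \<Rightarrow> real) \<Rightarrow> bool" for c r where
  monomial: "disk_polynomial c r (disk_monomial c r k m n)"
| add: "disk_polynomial c r f \<Longrightarrow> disk_polynomial c r g \<Longrightarrow> disk_polynomial c r (\<lambda>z. f z + g z)"

lemma disk_polynomial_mult:
  assumes "disk_polynomial c r f" "disk_polynomial c r g"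
  shows "disk_polynomial c r (\<lambda>z. f z * g z)"
  using assms(1)
proof induction
  case (monomial k m n)
  show ?case using assms(2)
  proof induction
    case (monomial k' m' n')
    \<comment> \<open>\<open>Re X * Re Y = Re (X * Y) / 2 + Re (X * cnj Y) / 2\<close>\<close>
    have "(\<lambda>z. disk_monomial c r k m n z * disk_monomial c r k' m' n' z) =
      (\<lambda>z. disk_monomial c r (k * k' / 2) (m + m') (n + n') z +
        disk_monomial c r (k * cnj k' / 2) (m + n') (n + m') z)"
    proof
      fix z
      let ?\<zeta> = "(z - c) / of_real r"
      define X where "X = k * ?\<zeta> ^ m * cnj ?\<zeta> ^ n"
      define Y where "Y = k' * ?\<zeta> ^ m' * cnj ?\<zeta> ^ n'"
      have "disk_monomial c r (k * k' / 2) (m + m') (n + n') z = Re (X * Y / 2)"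
        unfolding disk_monomial_def X_def Y_def
        by (intro arg_cong[where f=Re]) (simp add: power_add)
      moreover have "disk_monomial c r (k * cnj k' / 2) (m + n') (n + m') z = Re (X * cnj Y / 2)"
        unfolding disk_monomial_def X_def Y_def
        by (intro arg_cong[where f=Re]) (simp add: power_add)
      moreover have "Re X * Re Y = Re (X * Y / 2) + Re (X * cnj Y / 2)"
        by (simp add: field_simps)
      moreover have "disk_monomial c r k m n z = Re X" "disk_monomial c r k' m' n' z = Re Y"
        by (simp_all only: disk_monomial_def X_def Y_def)
      ultimately show "disk_monomial c r k m n z * disk_monomial c r k' m' n' z =
        disk_monomial c r (k * k' / 2) (m + m') (n + n') z +
        disk_monomial c r (k * cnj k' / 2) (m + n') (n + m') z"
        by (simp only:)
    qed
    then show ?case by (simp add: disk_polynomial.intros)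
  qed (simp add: distrib_left disk_polynomial.add)
qed (simp add: distrib_right disk_polynomial.add)

lemma disk_polynomial_of_real_polynomial:
  assumes "real_polynomial_function f" "r > 0"
  shows "disk_polynomial c r f"
  using assms(1)
proof induction
  case (const x)
  have "(\<lambda>z. x) = disk_monomial c r (of_real x) 0 0" by (simp add: disk_monomial_def fun_eq_iff)
  then show ?case by (simp add: disk_polynomial.monomial)
next
  case (linear f)
  interpret bounded_linear f by fact
  have f: "f z = Re z * f 1 + Im z * f \<i>" for z
  proof -
    have "z = Re z *\<^sub>R 1 + Im z *\<^sub>R \<i>" by (simp add: complex_eq_iff)
    then have "f z = f (Re z *\<^sub>R 1 + Im z *\<^sub>R \<i>)" by (rule arg_cong)
    then show ?thesis by (simp only: add scaleR) simp
  qed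
  have "f = (\<lambda>z. disk_monomial c r (of_real (f c)) 0 0 z +
    disk_monomial c r (of_real r * Complex (f 1) (- f \<i>)) 1 0 z)"
  proof
    fix z
    have "f z = f c + f (z - c)" by (simp add: diff)
    also have "f (z - c) = Re (Complex (f 1) (- f \<i>) * (z - c))" by (subst f) (simp add: mult.commute)
    also have "\<dots> = disk_monomial c r (of_real r * Complex (f 1) (- f \<i>)) 1 0 z"
      unfolding disk_monomial_def using assms(2) by (intro arg_cong[where f=Re]) simp
    finally show "f z = disk_monomial c r (of_real (f c)) 0 0 z +
        disk_monomial c r (of_real r * Complex (f 1) (- f \<i>)) 1 0 z"
      by (simp add: disk_monomial_def)
  qed
  then show ?case by (metis disk_polynomial.intros)
qed (auto intro: disk_polynomial.add disk_polynomial_mult)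

lemma disk_polynomial_poisson:
  assumes "disk_polynomial c r f" "r > 0"
  shows "\<exists>v. disk_polynomial c r v \<and> has_laplacian v f UNIV"
  using assms(1)
proof induction
  case (monomial k m n)
  let ?K = "k * (of_real r)\<^sup>2 / (4 * of_nat (Suc m) * of_nat (Suc n))"
  have "4 * of_nat (Suc m) * of_nat (Suc n) * ?K / (of_real r)\<^sup>2 = k"
    using assms(2) by (simp del: of_nat_Suc)
  then have "has_laplacian (disk_monomial c r ?K (Suc m) (Suc n)) (disk_monomial c r k m n) UNIV"
    using has_laplacian_disk_monomial[OF assms(2), of c ?K "Suc m" "Suc n"] by (simp del: of_nat_Suc)
  then show ?case using disk_polynomial.monomial by blast
next
  case (add f g)
  then show ?case using disk_polynomial.add has_laplacian_add by blast
qed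

lemma disk_polynomial_harmonic_extension:
  assumes "disk_polynomial c r f" "r > 0"
  shows "\<exists>v. has_laplacian v (\<lambda>z. 0) UNIV \<and> (\<forall>z\<in>sphere c r. v z = f z)"
  using assms(1)
proof induction
  case (monomial k m n)
  have harm: "has_laplacian (disk_monomial c r k m' n') (\<lambda>z. 0) UNIV" if "m' = 0 \<or> n' = 0" for m' n'
  proof -
    have "4 * of_nat m' * of_nat n' * k / (of_real r)\<^sup>2 = 0" using that by auto
    then have "disk_monomial c r (4 * of_nat m' * of_nat n' * k / (of_real r)\<^sup>2) (m' - 1) (n' - 1)
        = (\<lambda>z. 0)"
      by (simp only:) (simp add: disk_monomial_def fun_eq_iff)
    then show ?thesis
      using has_laplacian_disk_monomial[OF assms(2), of c k m' n'] by (simp only:)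
  qed
  have "disk_monomial c r k (m - n) (n - m) z = disk_monomial c r k m n z" if "z \<in> sphere c r" for z
  proof -
    let ?\<zeta> = "(z - c) / of_real r"
    have "cmod ?\<zeta> = 1"
      using that assms(2) by (simp add: norm_divide dist_norm norm_minus_commute)
    then have 1: "?\<zeta> * cnj ?\<zeta> = 1" by (simp only: complex_norm_square[symmetric]) simp
    have "?\<zeta> ^ m * cnj ?\<zeta> ^ n = ?\<zeta> ^ (m - n) * cnj ?\<zeta> ^ (n - m) * (?\<zeta> * cnj ?\<zeta>) ^ min m n"
    proof (cases "m \<le> n")
      case True
      then show ?thesis by (simp only: power_mult_distrib min_absorb1 diff_is_0_eq' power_0)
          (simp flip: power_add add: mult.left_commute)
    next
      case False
      then show ?thesis by (simp only: power_mult_distrib min_absorb2 diff_is_0_eq' power_0 nat_le_linear)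
          (simp flip: power_add mult.assoc)
    qed
    then show ?thesis unfolding 1 disk_monomial_def mult.assoc by simp
  qed
  then show ?case using harm[of "m - n" "n - m"] nat_le_linear[of m n]
    by (intro exI[of _ "disk_monomial c r k (m - n) (n - m)"]) auto
next
  case (add f g)
  then obtain v w where "has_laplacian v (\<lambda>z. 0) UNIV" "\<forall>z\<in>sphere c r. v z = f z"
    "has_laplacian w (\<lambda>z. 0) UNIV" "\<forall>z\<in>sphere c r. w z = g z" by blast
  then show ?case
    using has_laplacian_add[of v "\<lambda>z. 0" UNIV w "\<lambda>z. 0"] by (intro exI[of _ "\<lambda>z. v z + w z"]) auto
qed

lemma polynomial_dirichlet:
  assumes "real_polynomial_function f" "real_polynomial_function g" "r > 0"
  shows "\<exists>v. has_laplacian v f UNIV \<and> (\<forall>z\<in>sphere c r. v z = g z)"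
proof -
  obtain v where v: "disk_polynomial c r v" "has_laplacian v f UNIV"
    using disk_polynomial_poisson[OF disk_polynomial_of_real_polynomial[OF assms(1,3)] assms(3)] by blast
  have "disk_polynomial c r (\<lambda>z. -1)"
    by (rule disk_polynomial_of_real_polynomial[OF real_polynomial_function.intros(2) assms(3)])
  then have "disk_polynomial c r (\<lambda>z. g z + (\<lambda>z. -1) z * v z)"
    by (rule disk_polynomial.add[OF disk_polynomial_of_real_polynomial[OF assms(2,3)]
          disk_polynomial_mult[OF _ v(1)]])
  then obtain h where h: "has_laplacian h (\<lambda>z. 0) UNIV" "\<forall>z\<in>sphere c r. h z = g z + (\<lambda>z. -1) z * v z"
    using disk_polynomial_harmonic_extension[OF _ assms(3)] by blast
  show ?thesis
    using has_laplacian_add[OF v(2) h(1)] h(2) by (intro exI[of _ "\<lambda>z. v z + h z"]) auto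
qed

lemma geometric_uniform_limit:
  fixes v :: "nat \<Rightarrow> 'a \<Rightarrow> real"
  assumes "\<And>n x. x \<in> S \<Longrightarrow> \<bar>v (Suc n) x - v n x\<bar> \<le> B / 2 ^ n"
  obtains l where "\<And>n x. x \<in> S \<Longrightarrow> \<bar>v n x - l x\<bar> \<le> 2 * B / 2 ^ n"
proof
  fix n x assume x: "x \<in> S"
  have "summable (\<lambda>n. B * (1/2) ^ n)" by (intro summable_mult summable_geometric) simp
  then have "summable (\<lambda>n. v (Suc n) x - v n x)"
  proof (rule summable_comparison_test'[where N=0])
    show "norm (v (Suc n) x - v n x) \<le> B * (1/2) ^ n" for n
      using assms[OF x, of n] unfolding real_norm_def power_one_over by simp
  qed
  then have "convergent (\<lambda>n. v n x - v 0 x)"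
    by (simp add: summable_iff_convergent sum_lessThan_telescope[of "\<lambda>n. v n x"])
  then have "convergent (\<lambda>n. v n x - v 0 x + v 0 x)" by (intro convergent_add convergent_const)
  then have lim: "(\<lambda>n. v n x) \<longlonglongrightarrow> lim (\<lambda>n. v n x)" by (simp add: convergent_LIMSEQ_iff)
  have "\<bar>v n x - v m x\<bar> \<le> 2 * B / 2 ^ n - 2 * B / 2 ^ m" if "n \<le> m" for m
    using that
  proof (induction m rule: nat_induct_at_least)
    case (Suc m)
    have "2 * B / 2 ^ m - B / 2 ^ m = 2 * B / 2 ^ Suc m" by simp
    then show ?case using Suc assms[OF x, of m] by linarith
  qed simp
  moreover have "B \<ge> 0" using assms[OF x, of 0] by simp
  ultimately have "\<bar>v n x - v m x\<bar> \<le> 2 * B / 2 ^ n" if "n \<le> m" for m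
    using that by (smt (verit, best) divide_nonneg_nonneg mult_nonneg_nonneg zero_le_power)
  then show "\<bar>v n x - lim (\<lambda>n. v n x)\<bar> \<le> 2 * B / 2 ^ n"
    by (intro tendsto_upperbound[of "\<lambda>m. \<bar>v n x - v m x\<bar>" _ sequentially] tendsto_intros lim)
      (auto simp: eventually_sequentially)
qed

lemma geometric_small:
  fixes B e :: real
  assumes "e > 0"
  obtains n where "B / 2 ^ n < e"
proof -
  have "(\<lambda>n. B * (1/2) ^ n) \<longlonglongrightarrow> B * 0"
    by (intro tendsto_intros LIMSEQ_power_zero) simp
  then have "\<forall>\<^sub>F n in sequentially. B * (1/2) ^ n < e" using assms by (simp add: order_tendstoD(2))
  then obtain n where "B * (1/2) ^ n < e" by (auto simp: eventually_sequentially)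
  then show ?thesis using that[of n] by (simp add: power_one_over field_simps)
qed

text \<open>By the Weierstrass theorem, both data are uniform limits of polynomials at a geometric rate. The
  polynomial solutions then converge at the same rate, since \<open>disk_upper_bound\<close> bounds the
  difference of two solutions by the differences of their data.\<close>

theorem dirichlet_problem:
  fixes f g :: "complex \<Rightarrow> real"
  assumes "r > 0" "continuous_on (cball c r) f" "continuous_on (sphere c r) g"
  obtains u where "continuous_on (cball c r) u" "weak_laplacian u f (ball c r)"
    "\<And>z. z \<in> sphere c r \<Longrightarrow> u z = g z"
proof -
  have "\<forall>n. \<exists>q. real_polynomial_function q \<and> (\<forall>z\<in>cball c r. \<bar>f z - q z\<bar> < 1 / 2 ^ n)"
  proof
    fix n :: nat
    have "0 < 1 / (2 ^ n :: real)" by simp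
    then show "\<exists>q. real_polynomial_function q \<and> (\<forall>z\<in>cball c r. \<bar>f z - q z\<bar> < 1 / 2 ^ n)"
    proof (rule Stone_Weierstrass_real_polynomial_function[OF compact_cball assms(2)])
      fix q assume "real_polynomial_function q" "\<And>z. z \<in> cball c r \<Longrightarrow> \<bar>f z - q z\<bar> < 1 / 2 ^ n"
      then show ?thesis by (intro exI[of _ q] conjI ballI)
    qed
  qed
  from choice[OF this] obtain p where
    p': "\<forall>n. real_polynomial_function (p n) \<and> (\<forall>z\<in>cball c r. \<bar>f z - p n z\<bar> < 1 / 2 ^ n)" by blast
  have "\<forall>n. \<exists>q. real_polynomial_function q \<and> (\<forall>z\<in>sphere c r. \<bar>g z - q z\<bar> < 1 / 2 ^ n)"
  proof
    fix n :: nat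
    have "0 < 1 / (2 ^ n :: real)" by simp
    then show "\<exists>q. real_polynomial_function q \<and> (\<forall>z\<in>sphere c r. \<bar>g z - q z\<bar> < 1 / 2 ^ n)"
    proof (rule Stone_Weierstrass_real_polynomial_function[OF compact_sphere assms(3)])
      fix q assume "real_polynomial_function q" "\<And>z. z \<in> sphere c r \<Longrightarrow> \<bar>g z - q z\<bar> < 1 / 2 ^ n"
      then show ?thesis by (intro exI[of _ q] conjI ballI)
    qed
  qed
  from choice[OF this] obtain q where
    q': "\<forall>n. real_polynomial_function (q n) \<and> (\<forall>z\<in>sphere c r. \<bar>g z - q n z\<bar> < 1 / 2 ^ n)" by blast
  have pol: "\<And>n. real_polynomial_function (p n)" "\<And>n. real_polynomial_function (q n)"
    and p: "\<And>n z. z \<in> cball c r \<Longrightarrow> \<bar>f z - p n z\<bar> < 1 / 2 ^ n"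
    and q: "\<And>n z. z \<in> sphere c r \<Longrightarrow> \<bar>g z - q n z\<bar> < 1 / 2 ^ n"
    using p' q' by blast+
  have "\<exists>v. has_laplacian v (p n) UNIV \<and> (\<forall>z\<in>sphere c r. v z = q n z)" for n
    by (rule polynomial_dirichlet[OF pol assms(1)])
  then obtain v where "\<And>n. has_laplacian (v n) (p n) UNIV \<and> (\<forall>z\<in>sphere c r. v n z = q n z)"
    by metis
  then have v: "\<And>n. has_laplacian (v n) (p n) UNIV" "\<And>n z. z \<in> sphere c r \<Longrightarrow> v n z = q n z"
    by blast+
  have cont: "continuous_on S (v n)" for S n
    using continuous_on_has_laplacian(1)[OF v(1)] continuous_on_subset by blast
  have weak: "weak_laplacian (v n) (p n) (ball c r)" for n
    by (intro weak_laplacian_classical has_laplacian_subset[OF v(1)]) auto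
  \<comment> \<open>\<open>i\<close> and \<open>j\<close> are consecutive in either order so that both signs of the difference are
    covered; \<open>2 / 2 ^ n\<close> bounds the change of both data\<close>
  have step: "v i z - v j z \<le> 2 / 2 ^ n + (2 / 2 ^ n) * r\<^sup>2 / 4"
    if ij: "(i = n \<and> j = Suc n) \<or> (i = Suc n \<and> j = n)" and z: "z \<in> cball c r" for i j n z
  proof (rule disk_upper_bound[OF assms(1) _ weak_laplacian_diff[OF weak weak] _ _ _ z])
    have half: "1 / 2 ^ Suc n \<le> (1 / 2 ^ n :: real)" by (simp add: field_simps)
    show "v i z - v j z \<le> 2 / 2 ^ n" if "z \<in> sphere c r" for z
      using q[OF that, of n] q[OF that, of "Suc n"] half ij
      unfolding v(2)[OF that] by (auto simp: abs_less_iff)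
    show "p i z - p j z > - (2 / 2 ^ n)" if "z \<in> ball c r" for z
      using p[of z n] p[of z "Suc n"] half ij that by (auto simp: abs_less_iff)
  qed (auto intro!: continuous_intros cont)
  define B where "B = 2 + r\<^sup>2 / 2"
  have "\<bar>v (Suc n) z - v n z\<bar> \<le> B / 2 ^ n" if "z \<in> cball c r" for n z
  proof -
    have "2 / 2 ^ n + (2 / 2 ^ n) * r\<^sup>2 / 4 = B / 2 ^ n" by (simp add: B_def field_simps)
    moreover have "v (Suc n) z - v n z \<le> 2 / 2 ^ n + (2 / 2 ^ n) * r\<^sup>2 / 4"
      by (rule step[OF _ that]) simp
    moreover have "v n z - v (Suc n) z \<le> 2 / 2 ^ n + (2 / 2 ^ n) * r\<^sup>2 / 4"
      by (rule step[OF _ that]) simp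
    ultimately show ?thesis by linarith
  qed
  then obtain u where u: "\<And>n z. z \<in> cball c r \<Longrightarrow> \<bar>v n z - u z\<bar> \<le> 2 * B / 2 ^ n"
    using geometric_uniform_limit[of "cball c r" v B] by blast
  have B: "B > 0" "2 * B \<ge> 1" by (auto simp: B_def add_pos_nonneg)
  have close: "\<bar>p n z - f z\<bar> \<le> 2 * B / 2 ^ n" if "z \<in> cball c r" for n z
  proof -
    have "1 / 2 ^ n \<le> 2 * B / 2 ^ n" using B by (intro divide_right_mono) auto
    then show ?thesis using p[OF that, of n] by linarith
  qed
  show ?thesis
  proof (rule that)
    show "continuous_on (cball c r) u"
    proof (rule continuous_on_approx)
      fix e :: real assume "e > 0"
      then obtain n where "2 * B / 2 ^ n < e" by (rule geometric_small)
      then show "\<exists>v. continuous_on (cball c r) v \<and> (\<forall>z\<in>cball c r. \<bar>v z - u z\<bar> < e)"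
        using u cont by (meson le_less_trans)
    qed
    show "weak_laplacian u f (ball c r)"
    proof (rule weak_laplacian_limit)
      fix e :: real assume "e > 0"
      then obtain n where n: "2 * B / 2 ^ n < e" by (rule geometric_small)
      have "\<bar>v n z - u z\<bar> < e \<and> \<bar>p n z - f z\<bar> < e" if "z \<in> ball c r" for z
        using u[of z n] close[of z n] that n by auto
      then show "\<exists>v g. weak_laplacian v g (ball c r) \<and> (\<forall>z\<in>ball c r. \<bar>v z - u z\<bar> < e \<and> \<bar>g z - f z\<bar> < e)"
        using weak by blast
    qed simp
    show "u z = g z" if z: "z \<in> sphere c r" for z
    proof (rule ccontr)
      assume "u z \<noteq> g z"
      then obtain n where "(2 * B + 1) / 2 ^ n < \<bar>u z - g z\<bar>" using geometric_small[of "\<bar>u z - g z\<bar>"] by auto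
      moreover have "(2 * B + 1) / 2 ^ n = 2 * B / 2 ^ n + 1 / 2 ^ n" by (rule add_divide_distrib)
      ultimately show False using u[of z n] q[OF z, of n] v(2)[OF z, of n] z by auto
    qed
  qed
qed

section \<open>The semilinear Dirichlet problem\<close>

text \<open>The additional source term \<open>\<psi>\<close> is what allows an induction on the nonlinearity: part of it can be
  moved into \<open>\<psi>\<close>, evaluated at the previous iterate.\<close>

definition semilinear_solution ::
  "complex \<Rightarrow> real \<Rightarrow> (complex \<Rightarrow> real) \<Rightarrow> (complex \<Rightarrow> real) \<Rightarrow> (real \<Rightarrow> real) \<Rightarrow> (complex \<Rightarrow> real) \<Rightarrow> bool" where
  "semilinear_solution c r g \<psi> F u \<longleftrightarrow> continuous_on (cball c r) u \<and>
     weak_laplacian u (\<lambda>z. F (u z) + \<psi> z) (ball c r) \<and> (\<forall>z\<in>sphere c r. u z = g z)"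

text \<open>If \<open>u > u'\<close> at a point, then \<open>F(u) - F(u') \<ge> 0\<close> there, so the monotone part of the equation can only
  help: the contraction constant depends on the Lipschitz constant \<open>K\<close> of the perturbation \<open>H\<close> and
  not on \<open>F\<close>.\<close>

lemma semilinear_contraction:
  assumes "r > 0" and F: "mono F" and H: "\<And>x y. \<bar>H x - H y\<bar> \<le> K * \<bar>x - y\<bar>" "K \<ge> 0" "K * r\<^sup>2 \<le> 1"
    and u: "semilinear_solution c r g (\<lambda>z. H (v z) + \<psi> z) F u"
    and u': "semilinear_solution c r g (\<lambda>z. H (v' z) + \<psi> z) F u'"
    and "\<beta> > 0" and v: "\<And>z. z \<in> cball c r \<Longrightarrow> \<bar>v z - v' z\<bar> \<le> \<beta>"
    and z: "z \<in> cball c r"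
  shows "u z - u' z \<le> \<beta> / 2"
proof -
  \<comment> \<open>The value \<open>s = 2 * \<beta> / r\<^sup>2\<close> makes the bound equal to \<open>\<beta> / 2\<close>; it exceeds the perturbation \<open>K * \<beta>\<close>
    of the right side because \<open>K * r\<^sup>2 \<le> 1\<close>.\<close>
  have "u z - u' z \<le> 0 + (2 * \<beta> / r\<^sup>2) * r\<^sup>2 / 4"
  proof (rule disk_upper_bound[OF assms(1) _ _ _ _ _ z])
    show "weak_laplacian (\<lambda>z. u z - u' z)
      (\<lambda>z. (F (u z) + (H (v z) + \<psi> z)) - (F (u' z) + (H (v' z) + \<psi> z))) (ball c r)"
      using u u' by (intro weak_laplacian_diff) (auto simp: semilinear_solution_def)
    show "(F (u z) + (H (v z) + \<psi> z)) - (F (u' z) + (H (v' z) + \<psi> z)) > - (2 * \<beta> / r\<^sup>2)"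
      if "z \<in> ball c r" "u z - u' z > 0" for z
    proof -
      have "F (u' z) \<le> F (u z)" using F that(2) by (simp add: mono_def)
      moreover have "\<bar>H (v z) - H (v' z)\<bar> \<le> K * \<beta>"
        using H(1)[of "v z" "v' z"] mult_left_mono[OF v[of z] H(2)] that(1) by simp
      moreover have "K * \<beta> < 2 * \<beta> / r\<^sup>2"
      proof -
        have "K * r\<^sup>2 * \<beta> < 2 * \<beta>" using mult_right_mono[OF H(3), of \<beta>] \<open>\<beta> > 0\<close> by simp
        then show ?thesis using \<open>r > 0\<close> by (simp add: field_simps)
      qed
      ultimately show ?thesis by linarith
    qed
    show "continuous_on (cball c r) (\<lambda>z. u z - u' z)"
      using u u' by (intro continuous_intros) (auto simp: semilinear_solution_def)
  qed (use u u' \<open>\<beta> > 0\<close> in \<open>auto simp: semilinear_solution_def\<close>)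
  then show ?thesis using \<open>r > 0\<close> by (simp add: field_simps)
qed

text \<open>Picard iteration: \<open>H\<close> is evaluated at the previous iterate, and the equation with nonlinearity \<open>F\<close>
  and a known source is solved. As the size of \<open>F\<close> does not enter the condition on \<open>K\<close>, the step
  can be repeated with the same step size.\<close>

lemma semilinear_perturbation:
  assumes "r > 0" and F: "mono F" "\<And>x y. \<bar>F x - F y\<bar> \<le> L * \<bar>x - y\<bar>" "L \<ge> 0"
    and H: "\<And>x y. \<bar>H x - H y\<bar> \<le> K * \<bar>x - y\<bar>" "K \<ge> 0" "K * r\<^sup>2 \<le> 1"
    and solv: "\<And>\<psi>. continuous_on (cball c r) \<psi> \<Longrightarrow> \<exists>u. semilinear_solution c r g \<psi> F u"
    and \<psi>: "continuous_on (cball c r) \<psi>"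
  shows "\<exists>u. semilinear_solution c r g \<psi> (\<lambda>x. F x + H x) u"
proof -
  have contH: "continuous_on UNIV H"
    by (rule lipschitz_on_continuous_on[of K]) (use H in \<open>auto simp: lipschitz_on_def dist_real_def\<close>)
  define P where "P v = semilinear_solution c r g (\<lambda>z. H (v z) + \<psi> z) F" for v
  have "\<exists>u. P v u" if "continuous_on (cball c r) v" for v
    unfolding P_def
    by (rule solv) (auto intro!: continuous_intros \<psi> continuous_on_compose2[OF contH that])
  then obtain S where S: "\<And>v. continuous_on (cball c r) v \<Longrightarrow> P v (S v)" by metis
  define x where "x n = (S ^^ n) (\<lambda>z. 0)" for n
  have P_cont: "continuous_on (cball c r) u" if "P v u" for u v
    using that by (simp add: P_def semilinear_solution_def)
  have cont: "continuous_on (cball c r) (x n)" for n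
    by (induction n) (auto simp: x_def intro: P_cont S)
  have Px: "P (x n) (x (Suc n))" for n
    using S[OF cont[of n]] by (simp add: x_def)
  have "compact ((\<lambda>z. x 1 z - x 0 z) ` cball c r)"
    by (intro compact_continuous_image continuous_intros cont) auto
  then have "bounded ((\<lambda>z. x 1 z - x 0 z) ` cball c r)" by (rule compact_imp_bounded)
  then obtain \<beta> where "\<beta> > 0 \<and> (\<forall>y\<in>(\<lambda>z. x 1 z - x 0 z) ` cball c r. norm y \<le> \<beta>)"
    unfolding bounded_pos by (rule exE)
  then have \<beta>: "\<beta> > 0" "\<And>z. z \<in> cball c r \<Longrightarrow> \<bar>x 1 z - x 0 z\<bar> \<le> \<beta>" by simp_all
  have step: "\<bar>x (Suc n) z - x n z\<bar> \<le> \<beta> / 2 ^ n" if "z \<in> cball c r" for n z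
    using that
  proof (induction n arbitrary: z)
    case (Suc n)
    have pos: "\<beta> / 2 ^ n > 0" using \<beta>(1) by simp
    have "x (Suc (Suc n)) z - x (Suc n) z \<le> \<beta> / 2 ^ n / 2"
      using Px[of "Suc n", unfolded P_def] Px[of n, unfolded P_def]
      by (rule semilinear_contraction[OF assms(1) F(1) H _ _ pos _ Suc.prems]) (rule Suc.IH)
    moreover have "x (Suc n) z - x (Suc (Suc n)) z \<le> \<beta> / 2 ^ n / 2"
      using Px[of n, unfolded P_def] Px[of "Suc n", unfolded P_def]
      by (rule semilinear_contraction[OF assms(1) F(1) H _ _ pos _ Suc.prems])
        (subst abs_minus_commute, rule Suc.IH)
    ultimately show ?case by (simp add: abs_le_iff)
  qed (use \<beta> in simp)
  then obtain u where u: "\<And>n z. z \<in> cball c r \<Longrightarrow> \<bar>x n z - u z\<bar> \<le> 2 * \<beta> / 2 ^ n"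
    using geometric_uniform_limit[of "cball c r" x \<beta>] by blast
  have mono_bound: "2 * \<beta> / 2 ^ Suc n \<le> 2 * \<beta> / 2 ^ n" for n
    using \<beta>(1) by (simp add: field_simps)
  have "continuous_on (cball c r) u"
  proof (rule continuous_on_approx)
    fix e :: real assume "e > 0"
    then obtain n where "2 * \<beta> / 2 ^ n < e" by (rule geometric_small)
    then show "\<exists>v. continuous_on (cball c r) v \<and> (\<forall>z\<in>cball c r. \<bar>v z - u z\<bar> < e)"
      using u cont by (meson le_less_trans)
  qed
  moreover have "weak_laplacian u (\<lambda>z. F (u z) + H (u z) + \<psi> z) (ball c r)"
  proof (rule weak_laplacian_limit)
    fix e :: real assume "e > 0"
    then obtain n where n: "(1 + L + K) * (2 * \<beta>) / 2 ^ n < e" by (rule geometric_small)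
    define b where "b = 2 * \<beta> / 2 ^ n"
    have b: "b \<ge> 0" "(1 + L + K) * b < e" using n \<beta>(1) by (auto simp: b_def)
    have "L * b \<ge> 0" "K * b \<ge> 0" using b F(3) H(2) by auto
    then have be: "b < e" "L * b + K * b < e" using b by (auto simp: algebra_simps)
    have "\<bar>x (Suc n) z - u z\<bar> < e \<and>
      \<bar>F (x (Suc n) z) + (H (x n z) + \<psi> z) - (F (u z) + H (u z) + \<psi> z)\<bar> < e" if "z \<in> ball c r" for z
    proof -
      have z: "z \<in> cball c r" using that by simp
      have 1: "\<bar>x (Suc n) z - u z\<bar> \<le> b" "\<bar>x n z - u z\<bar> \<le> b"
        using u[OF z, of "Suc n"] u[OF z, of n] mono_bound[of n] by (auto simp: b_def)
      have "\<bar>F (x (Suc n) z) - F (u z)\<bar> \<le> L * b" "\<bar>H (x n z) - H (u z)\<bar> \<le> K * b"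
        using F(2)[of "x (Suc n) z" "u z"] H(1)[of "x n z" "u z"]
          mult_left_mono[OF 1(1) F(3)] mult_left_mono[OF 1(2) H(2)] by linarith+
      then show ?thesis using be 1 by linarith
    qed
    then show "\<exists>v g. weak_laplacian v g (ball c r) \<and>
      (\<forall>z\<in>ball c r. \<bar>v z - u z\<bar> < e \<and> \<bar>g z - (F (u z) + H (u z) + \<psi> z)\<bar> < e)"
      using Px[of n] unfolding P_def semilinear_solution_def by blast
  qed simp
  moreover have "u z = g z" if z: "z \<in> sphere c r" for z
  proof (rule ccontr)
    assume "u z \<noteq> g z"
    then obtain n where "2 * \<beta> / 2 ^ n < \<bar>u z - g z\<bar>"
      using geometric_small[of "\<bar>u z - g z\<bar>"] by auto
    moreover have "x (Suc n) z = g z" using Px[of n] z by (simp add: P_def semilinear_solution_def)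
    moreover have "\<bar>x (Suc n) z - u z\<bar> \<le> 2 * \<beta> / 2 ^ Suc n" by (rule u) (use z in simp)
    ultimately show False using mono_bound[of n] by linarith
  qed
  ultimately show ?thesis unfolding semilinear_solution_def by blast
qed

text \<open>Continuity method: the equations \<open>\<Delta>u = t F(u) + \<psi>\<close> are solvable for \<open>t = 0\<close> and all \<open>\<psi>\<close>,
  and solvability for \<open>t\<close> implies solvability for \<open>t + \<delta>\<close> with a fixed \<open>\<delta>\<close>, so \<open>t = 1\<close> is reached after finitely many
  steps.\<close>

theorem semilinear_dirichlet_problem:
  assumes "r > 0" and F: "mono F" "\<And>x y. \<bar>F x - F y\<bar> \<le> L * \<bar>x - y\<bar>" "L \<ge> 0"
    and g: "continuous_on (sphere c r) g"
  obtains u where "continuous_on (cball c r) u" "weak_laplacian u (\<lambda>z. F (u z)) (ball c r)"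
    "\<And>z. z \<in> sphere c r \<Longrightarrow> u z = g z"
proof -
  obtain N where N: "real (Suc N) > L * r\<^sup>2" by (meson reals_Archimedean2 le_less_trans less_Suc_eq of_nat_less_iff order.strict_trans)
  define \<delta> where "\<delta> = 1 / real (Suc N)"
  have \<delta>: "\<delta> > 0" "\<delta> * L * r\<^sup>2 \<le> 1" using N by (auto simp: \<delta>_def field_simps)
  have lip: "\<bar>k * F x - k * F y\<bar> \<le> (k * L) * \<bar>x - y\<bar>" if "k \<ge> 0" for k x y
    using mult_left_mono[OF F(2)[of x y] that] that
    by (simp add: abs_mult mult.assoc flip: right_diff_distrib)
  have "\<exists>u. semilinear_solution c r g \<psi> (\<lambda>x. (real k * \<delta>) * F x) u"
    if "continuous_on (cball c r) \<psi>" for k \<psi>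
    using that
  proof (induction k arbitrary: \<psi>)
    case 0
    then obtain u where "continuous_on (cball c r) u" "weak_laplacian u \<psi> (ball c r)"
      "\<And>z. z \<in> sphere c r \<Longrightarrow> u z = g z"
      using dirichlet_problem[OF assms(1) _ g] by blast
    then show ?case by (auto simp: semilinear_solution_def)
  next
    case (Suc k)
    have "\<exists>u. semilinear_solution c r g \<psi> (\<lambda>x. (real k * \<delta>) * F x + \<delta> * F x) u"
    proof (rule semilinear_perturbation[OF assms(1) _ lip _ lip])
      show "mono (\<lambda>x. (real k * \<delta>) * F x)"
        using F(1) \<delta> by (auto simp: mono_def intro!: mult_left_mono)
    qed (use \<delta> F(3) Suc in auto)
    then show ?case by (simp add: algebra_simps)
  qed
  from this[of "\<lambda>z. 0" "Suc N"] obtain u where "semilinear_solution c r g (\<lambda>z. 0) (\<lambda>x. (real (Suc N) * \<delta>) * F x) u"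
    by auto
  then show ?thesis by (intro that[of u]) (auto simp: semilinear_solution_def \<delta>_def)
qed

section \<open>Interior regularity\<close>

lemma derivative_le_of_linear_bound:
  fixes k :: "real \<Rightarrow> real"
  assumes "(k has_real_derivative D) (at 0)" "k 0 = 0" "d > 0"
    and "\<And>t. 0 < t \<Longrightarrow> t < d \<Longrightarrow> k t \<le> s * t"
  shows "D \<le> s"
proof (rule ccontr)
  assume "\<not> D \<le> s"
  then have pos: "0 < D - s" by simp
  have "((\<lambda>t. k t - s * t) has_real_derivative D - s) (at 0)"
    using assms(1) by (auto intro!: derivative_eq_intros)
  from DERIV_pos_inc_right[OF this pos] obtain e where
    e: "e > 0" "\<And>h. 0 < h \<Longrightarrow> h < e \<Longrightarrow> k 0 - s * 0 < k h - s * h" by auto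
  define t where "t = min d e / 2"
  have t: "0 < t" "t < d" "t < e" using e \<open>d > 0\<close> by (auto simp: t_def min_def)
  show False using e(2)[OF t(1,3)] assms(4)[OF t(1,2)] assms(2) by simp
qed

text \<open>The odd part \<open>\<phi>\<close> of \<open>v\<close> under the reflection that reverses the direction \<open>b\<close> vanishes on the
  axis of the reflection. On the half square \<open>\<bar>x\<bar> \<le> d\<close>, \<open>0 \<le> y \<le> d\<close>, with \<open>y\<close> the coordinate along \<open>b\<close>, it is
  dominated by the barrier \<open>\<psi> = (M / d\<^sup>2) (x\<^sup>2 - y\<^sup>2 + 2 d y) + (N / 2) y (d - y)\<close>: the first summand is
  harmonic and at least \<open>M\<close> on the other three sides, the second has Laplacian \<open>- N\<close>. Since \<open>\<psi>\<close>
  vanishes at the origin and grows linearly in \<open>y\<close>, this bounds the derivative there.\<close>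

lemma interior_gradient_estimate:
  assumes v: "has_laplacian v g S" and S: "ball z0 (2 * d) \<subseteq> S" and "d > 0"
    and M: "\<And>z. z \<in> S \<Longrightarrow> \<bar>v z\<bar> \<le> M" and N: "\<And>z. z \<in> S \<Longrightarrow> \<bar>g z\<bar> < N"
    and b: "b \<in> Basis"
  shows "\<bar>partial_deriv b v z0\<bar> \<le> 2 * M / d + N * d / 2"
proof -
  have z0: "z0 \<in> S" using S \<open>d > 0\<close> by auto
  have M0: "M \<ge> 0" and N0: "N > 0" using M[OF z0] N[OF z0] by auto
  define a where "a = (if b = 1 then \<i> else 1)"
  have ab: "a \<in> Basis" "a \<noteq> b" using b by (auto simp: a_def Basis_complex_def)
  \<comment> \<open>coordinates with \<open>Re \<zeta>\<close> along \<open>a\<close> and \<open>Im \<zeta>\<close> along \<open>b\<close>; \<open>\<sigma> = - 1\<close> is the reflected point\<close>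
  define A where "A \<sigma> \<zeta> = z0 + Re \<zeta> *\<^sub>R a + (\<sigma> * Im \<zeta>) *\<^sub>R b" for \<sigma> :: real and \<zeta>
  have lapA: "has_laplacian (\<lambda>\<zeta>. v (A \<sigma> \<zeta>)) (\<lambda>\<zeta>. g (A \<sigma> \<zeta>)) (A \<sigma> -` S)" if "\<sigma>\<^sup>2 = 1" for \<sigma>
  proof (rule has_laplacian_affine[OF v, where d="\<lambda>c. if c = 1 then a else b"
        and s="\<lambda>c. if c = 1 then 1 else \<sigma>"])
    show "continuous_on UNIV (A \<sigma>)" unfolding A_def by (intro continuous_intros)
  qed (use ab b that in \<open>auto simp: A_def Basis_complex_def algebra_simps\<close>)
  define C where "C = cbox (Complex (-d) 0) (Complex d d)"
  define G where "G = box (Complex (-d) 0) (Complex d d)"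
  have AS: "A \<sigma> \<zeta> \<in> S" if "\<sigma>\<^sup>2 = 1" "\<zeta> \<in> C" for \<sigma> \<zeta>
  proof -
    have \<zeta>: "\<bar>Re \<zeta>\<bar> \<le> d" "\<bar>Im \<zeta>\<bar> \<le> d" using that by (auto simp: C_def in_cbox_complex_iff)
    have \<sigma>: "\<bar>\<sigma>\<bar> = 1" using that(1) by (auto simp: power2_eq_1_iff)
    have "(dist z0 (A \<sigma> \<zeta>))\<^sup>2 = (Re \<zeta>)\<^sup>2 + (Im \<zeta>)\<^sup>2"
      using b that(1) unfolding dist_norm cmod_power2
      by (auto simp: A_def a_def Basis_complex_def power_mult_distrib)
    also have "\<dots> \<le> d\<^sup>2 + d\<^sup>2" using \<zeta> \<open>d > 0\<close> by (intro add_mono) (simp_all add: power2_le_iff_abs_le)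
    also have "\<dots> < (2 * d)\<^sup>2" using \<open>d > 0\<close> by (simp add: power2_eq_square)
    finally have "dist z0 (A \<sigma> \<zeta>) < 2 * d" by (rule power_less_imp_less_base) (use \<open>d > 0\<close> in simp)
    then show ?thesis using S by auto
  qed
  have GC: "G \<subseteq> C" unfolding G_def C_def by (rule box_subset_cbox)
  define \<phi> where "\<phi> \<zeta> = (1/2) * (v (A 1 \<zeta>) - v (A (-1) \<zeta>))" for \<zeta>
  have lap\<phi>: "has_laplacian \<phi> (\<lambda>\<zeta>. (1/2) * (g (A 1 \<zeta>) - g (A (-1) \<zeta>))) (A 1 -` S \<inter> A (-1) -` S)"
  proof -
    have o: "open (A 1 -` S \<inter> A (-1) -` S)"
      using lapA[of 1] lapA[of "-1"] by (intro open_Int) (auto simp: has_laplacian_def)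
    show ?thesis
      unfolding \<phi>_def
      by (intro has_laplacian_cmult has_laplacian_diff has_laplacian_subset[OF lapA _ _] o) auto
  qed
  have CS: "C \<subseteq> A 1 -` S \<inter> A (-1) -` S" using AS by auto
  define p where "p = M / d\<^sup>2"
  define \<psi> where "\<psi> \<zeta> = p * (Re \<zeta>)\<^sup>2 + (- p - N / 2) * (Im \<zeta>)\<^sup>2 + 0 * Re \<zeta> + (2 * p * d + N * d / 2) * Im \<zeta> + 0"
    for \<zeta>
  have p: "p \<ge> 0" "p * d\<^sup>2 = M" using M0 \<open>d > 0\<close> by (auto simp: p_def)
  have \<psi>_eq: "\<psi> \<zeta> = p * (Re \<zeta>)\<^sup>2 + p * (Im \<zeta> * (2 * d - Im \<zeta>)) + (N / 2) * (Im \<zeta> * (d - Im \<zeta>))" for \<zeta>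
    by (simp add: \<psi>_def algebra_simps power2_eq_square)
  have lap\<psi>: "has_laplacian \<psi> (\<lambda>\<zeta>. 2 * p + 2 * (- p - N / 2)) UNIV"
    unfolding \<psi>_def by (rule has_laplacian_quadratic)
  have \<phi>M: "\<bar>\<phi> \<zeta>\<bar> \<le> M" if "\<zeta> \<in> C" for \<zeta>
    using M[OF AS[of 1 \<zeta>]] M[OF AS[of "-1" \<zeta>]] that by (auto simp: \<phi>_def)
  have bound: "\<sigma> * \<phi> \<zeta> - \<psi> \<zeta> \<le> 0" if \<sigma>: "\<sigma> = 1 \<or> \<sigma> = -1" and "\<zeta> \<in> C" for \<sigma> \<zeta>
  proof (rule maximum_principle[OF _ GC _ _ _ _ \<open>\<zeta> \<in> C\<close>])
    show "compact C" by (simp add: C_def)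
    show "continuous_on C (\<lambda>\<zeta>. \<sigma> * \<phi> \<zeta> - \<psi> \<zeta>)"
      using continuous_on_subset[OF continuous_on_has_laplacian(1)[OF lap\<phi>] CS]
        continuous_on_subset[OF continuous_on_has_laplacian(1)[OF lap\<psi>]]
      by (intro continuous_intros) auto
    show "weak_laplacian (\<lambda>\<zeta>. \<sigma> * \<phi> \<zeta> - \<psi> \<zeta>)
      (\<lambda>\<zeta>. \<sigma> * ((1/2) * (g (A 1 \<zeta>) - g (A (-1) \<zeta>))) - (2 * p + 2 * (- p - N / 2))) G"
      using GC CS
      by (intro weak_laplacian_classical has_laplacian_diff has_laplacian_cmult
          has_laplacian_subset[OF lap\<phi>] has_laplacian_subset[OF lap\<psi>]) (auto simp: G_def)
    show "\<sigma> * ((1/2) * (g (A 1 \<zeta>) - g (A (-1) \<zeta>))) - (2 * p + 2 * (- p - N / 2)) > 0" if "\<zeta> \<in> G" for \<zeta>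
      using N[OF AS[OF _ subsetD[OF GC that], of 1]] N[OF AS[OF _ subsetD[OF GC that], of "-1"]] \<sigma>
      by (auto simp: abs_less_iff field_simps)
    show "\<sigma> * \<phi> \<zeta> - \<psi> \<zeta> \<le> 0" if "\<zeta> \<in> C - G" for \<zeta>
    proof -
      have \<zeta>: "\<bar>Re \<zeta>\<bar> \<le> d" "0 \<le> Im \<zeta>" "Im \<zeta> \<le> d" using that by (auto simp: C_def in_cbox_complex_iff)
      have nn: "p * (Re \<zeta>)\<^sup>2 \<ge> 0" "p * (Im \<zeta> * (2 * d - Im \<zeta>)) \<ge> 0" "(N / 2) * (Im \<zeta> * (d - Im \<zeta>)) \<ge> 0"
        using \<zeta> p N0 \<open>d > 0\<close> by auto
      have "\<not> (\<bar>Re \<zeta>\<bar> < d \<and> 0 < Im \<zeta> \<and> Im \<zeta> < d)"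
        using that by (auto simp: G_def in_box_complex_iff abs_less_iff)
      then consider "Im \<zeta> = 0" | "Im \<zeta> = d" | "\<bar>Re \<zeta>\<bar> = d"
        using \<zeta> by linarith
      then show ?thesis
      proof cases
        case 1
        then have "\<phi> \<zeta> = 0" by (simp add: \<phi>_def A_def)
        then show ?thesis using nn by (simp add: \<psi>_eq)
      next
        case 2
        then have "p * (Im \<zeta> * (2 * d - Im \<zeta>)) = M" using p by (simp add: power2_eq_square)
        then have "\<psi> \<zeta> \<ge> M" using nn by (simp add: \<psi>_eq)
        then show ?thesis using \<phi>M[of \<zeta>] that \<sigma> by auto
      next
        case 3
        then have "(Re \<zeta>)\<^sup>2 = d\<^sup>2" by (metis power2_abs)
        then have "\<psi> \<zeta> \<ge> M" using nn p by (simp add: \<psi>_eq)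
        then show ?thesis using \<phi>M[of \<zeta>] that \<sigma> by auto
      qed
    qed
  qed
  let ?s = "2 * M / d + N * d / 2"
  have s: "?s = 2 * p * d + N * d / 2" using \<open>d > 0\<close> by (simp add: p_def power2_eq_square)
  have key: "\<sigma> * (v (z0 + t *\<^sub>R b) - v (z0 - t *\<^sub>R b)) \<le> 2 * ?s * t"
    if \<sigma>: "\<sigma> = 1 \<or> \<sigma> = -1" and t: "0 < t" "t < d" for \<sigma> t
  proof -
    have "\<sigma> * \<phi> (Complex 0 t) \<le> \<psi> (Complex 0 t)"
      using bound[OF \<sigma>, of "Complex 0 t"] t by (auto simp: C_def in_cbox_complex_iff)
    also have "\<psi> (Complex 0 t) \<le> ?s * t"
      using p N0 unfolding s by (simp add: \<psi>_def algebra_simps)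
    finally have "2 * (\<sigma> * \<phi> (Complex 0 t)) \<le> 2 * ?s * t" by linarith
    moreover have "2 * (\<sigma> * \<phi> (Complex 0 t)) = \<sigma> * (v (z0 + t *\<^sub>R b) - v (z0 - t *\<^sub>R b))"
      by (simp add: \<phi>_def A_def)
    ultimately show ?thesis by (simp only:)
  qed
  have vz: "has_partial b v (partial_deriv b v z0) z0"
    using v b z0 by (intro Ck_2_parts(2)) (auto simp: has_laplacian_def)
  have d1: "((\<lambda>t. v (z0 + t *\<^sub>R b)) has_real_derivative partial_deriv b v z0) (at 0)"
    using vz by (simp add: has_partial_def)
  have "((\<lambda>t. v (z0 + (- t) *\<^sub>R b)) has_real_derivative - partial_deriv b v z0) (at 0)"
    using d1 DERIV_mirror[of "\<lambda>t. v (z0 + t *\<^sub>R b)" "partial_deriv b v z0" 0] by simp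
  from DERIV_diff[OF d1 this]
  have d2: "((\<lambda>t. v (z0 + t *\<^sub>R b) - v (z0 - t *\<^sub>R b)) has_real_derivative 2 * partial_deriv b v z0) (at 0)"
    by simp
  have "\<sigma> * (2 * partial_deriv b v z0) \<le> 2 * ?s" if \<sigma>: "\<sigma> = 1 \<or> \<sigma> = -1" for \<sigma>
    by (rule derivative_le_of_linear_bound[OF DERIV_cmult[OF d2] _ \<open>d > 0\<close> key[OF \<sigma>]]) auto
  from this[of 1] this[of "-1"] show ?thesis by (simp add: abs_le_iff)
qed

lemma geometric_tendsto:
  fixes a :: "nat \<Rightarrow> real"
  assumes "\<And>n. \<bar>a n - l\<bar> \<le> B / 2 ^ n"
  shows "a \<longlonglongrightarrow> l"
proof (rule LIMSEQ_I)
  fix e :: real assume "e > 0"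
  then obtain N where N: "B / 2 ^ N < e" by (rule geometric_small)
  have "B \<ge> 0" using assms[of 0] by simp
  have "norm (a n - l) < e" if "n \<ge> N" for n
  proof -
    have "B / 2 ^ n \<le> B / 2 ^ N"
      using that \<open>B \<ge> 0\<close> by (intro divide_left_mono power_increasing) auto
    then show ?thesis using assms[of n] N by simp
  qed
  then show "\<exists>N. \<forall>n\<ge>N. norm (a n - l) < e" by blast
qed

lemma has_partial_limit:
  assumes "open H" "w \<in> H" and v: "\<And>n z. z \<in> H \<Longrightarrow> has_partial b (v n) (D n z) z"
    and lim: "\<And>z. z \<in> H \<Longrightarrow> (\<lambda>n. v n z) \<longlonglongrightarrow> u z"
    and D: "\<And>n z. z \<in> H \<Longrightarrow> \<bar>D n z - l z\<bar> \<le> B / 2 ^ n"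
  shows "has_partial b u (l w) w"
proof -
  obtain d where d: "d > 0" "\<And>t. \<bar>t\<bar> < d \<Longrightarrow> w + t *\<^sub>R b \<in> H"
    using eventually_on_line[OF assms(1,2), of b] by (auto simp: eventually_nhds_metric dist_real_def)
  let ?I = "{-d<..<d}"
  have I: "w + t *\<^sub>R b \<in> H" if "t \<in> ?I" for t using d(2)[of t] that by (simp add: abs_less_iff)
  have "\<exists>k. \<forall>t\<in>?I. (\<lambda>n. v n (w + t *\<^sub>R b)) \<longlonglongrightarrow> k t \<and>
      (k has_derivative (\<lambda>h. l (w + t *\<^sub>R b) * h)) (at t within ?I)"
  proof (rule has_derivative_sequence[where f'="\<lambda>n t h. D n (w + t *\<^sub>R b) * h" and ?x0.0=0 and l="u w"])
    show "((\<lambda>t. v n (w + t *\<^sub>R b)) has_derivative (\<lambda>h. D n (w + t *\<^sub>R b) * h)) (at t within ?I)"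
      if "t \<in> ?I" for n t
      using has_partial_along_line[OF v[OF I[OF that]], of n]
      unfolding has_field_derivative_def by (rule has_derivative_at_withinI)
    show "\<forall>\<^sub>F n in sequentially. \<forall>t\<in>?I. \<forall>h. norm (D n (w + t *\<^sub>R b) * h - l (w + t *\<^sub>R b) * h) \<le> e * norm h"
      if "e > 0" for e
    proof -
      have "(\<lambda>n. B / 2 ^ n) \<longlonglongrightarrow> 0"
        by (rule geometric_tendsto[where B="\<bar>B\<bar>"]) simp
      then have "\<forall>\<^sub>F n in sequentially. B / 2 ^ n < e" using that by (simp add: order_tendstoD(2))
      then show ?thesis
      proof (rule eventually_mono, intro ballI allI)
        fix n t h assume n: "B / 2 ^ n < e" and t: "t \<in> ?I"
        have "\<bar>D n (w + t *\<^sub>R b) - l (w + t *\<^sub>R b)\<bar> \<le> e" using D[OF I[OF t], of n] n by linarith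
        then show "norm (D n (w + t *\<^sub>R b) * h - l (w + t *\<^sub>R b) * h) \<le> e * norm h"
          by (simp add: abs_mult mult_right_mono flip: left_diff_distrib)
      qed
    qed
  qed (use d lim[OF assms(2)] in auto)
  then obtain k where k: "\<And>t. t \<in> ?I \<Longrightarrow> (\<lambda>n. v n (w + t *\<^sub>R b)) \<longlonglongrightarrow> k t"
    "\<And>t. t \<in> ?I \<Longrightarrow> (k has_derivative (\<lambda>h. l (w + t *\<^sub>R b) * h)) (at t within ?I)" by blast
  have ku: "k t = u (w + t *\<^sub>R b)" if "t \<in> ?I" for t
    using LIMSEQ_unique[OF k(1)[OF that] lim[OF I[OF that]]] .
  have "(k has_derivative (\<lambda>h. l w * h)) (at 0)"
    using k(2)[of 0] d(1) at_within_open[of 0 ?I] by simp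
  then have "(k has_real_derivative l w) (at 0)" by (simp add: has_field_derivative_def)
  moreover have "\<forall>\<^sub>F t in nhds 0. k t = u (w + t *\<^sub>R b)"
    using ku d(1) eventually_nhds_in_open[of ?I 0] by (auto elim: eventually_mono)
  ultimately show ?thesis
    unfolding has_partial_def using DERIV_cong_ev[OF refl _ refl, of k "\<lambda>t. u (w + t *\<^sub>R b)" 0 "l w"] by simp
qed

text \<open>The gradient estimate applied to differences of approximants shows that their gradients converge
  locally uniformly.\<close>

lemma weak_laplacian_imp_C1:
  assumes "weak_laplacian u f G"
  shows "Ck_on (Suc 0) u G"
proof (rule Ck_on_local)
  fix z assume "z \<in> G"
  have G: "open G" using assms by (simp add: weak_laplacian_def)
  obtain e where e: "e > 0" "ball z e \<subseteq> G" using G \<open>z \<in> G\<close> by (meson open_contains_ball)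
  define d where "d = e / 3"
  have d: "d > 0" "e = 3 * d" using e by (auto simp: d_def)
  have "\<exists>v g. has_laplacian v g G \<and> (\<forall>z\<in>G. \<bar>v z - u z\<bar> < 1 / 2 ^ n \<and> \<bar>g z - f z\<bar> < 1 / 2 ^ n)" for n :: nat
    using assms unfolding weak_laplacian_def by (metis zero_less_divide_1_iff zero_less_power zero_less_numeral)
  then obtain v g where vg: "\<And>n. has_laplacian (v n) (g n) G"
    "\<And>n. \<forall>z\<in>G. \<bar>v n z - u z\<bar> < 1 / 2 ^ n \<and> \<bar>g n z - f z\<bar> < 1 / 2 ^ n" by metis
  have Ck2: "Ck_on 2 (v n) G" for n using vg(1)[of n] by (simp add: has_laplacian_def)
  have part: "has_partial b (v n) (partial_deriv b (v n) w) w" if "b \<in> Basis" "w \<in> G" for b n w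
    by (rule Ck_2_parts(2)[OF Ck2 that])
  have half: "1 / 2 ^ Suc n \<le> (1 / 2 ^ n :: real)" for n by (simp add: field_simps)
  let ?H = "ball z d"
  have HG: "?H \<subseteq> G" using e d by (auto simp: subset_iff)
  have step: "\<bar>partial_deriv b (v (Suc n)) w - partial_deriv b (v n) w\<bar> \<le> (4 / d + d) / 2 ^ n"
    if b: "b \<in> Basis" and w: "w \<in> ?H" for b n w
  proof -
    let ?v = "\<lambda>z. v (Suc n) z - v n z"
    have "\<bar>partial_deriv b ?v w\<bar> \<le> 2 * (2 / 2 ^ n) / d + (2 / 2 ^ n) * d / 2"
    proof (rule interior_gradient_estimate[OF has_laplacian_diff[OF vg(1) vg(1)] _ d(1) _ _ b])
      have "ball w (2 * d) \<subseteq> ball z e"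
      proof
        fix y assume "y \<in> ball w (2 * d)"
        then show "y \<in> ball z e" using w d(2) dist_triangle[of z y w] by simp
      qed
      then show "ball w (2 * d) \<subseteq> G" using e(2) by blast
      show "\<bar>v (Suc n) z - v n z\<bar> \<le> 2 / 2 ^ n" "\<bar>g (Suc n) z - g n z\<bar> < 2 / 2 ^ n" if "z \<in> G" for z
        using vg(2)[of n, rule_format, OF that] vg(2)[of "Suc n", rule_format, OF that] half[of n]
        by linarith+
    qed
    also have "\<dots> = (4 / d + d) / 2 ^ n" using d(1) by (simp add: field_simps)
    finally have "\<bar>partial_deriv b ?v w\<bar> \<le> (4 / d + d) / 2 ^ n" .
    moreover have "partial_deriv b ?v w = partial_deriv b (v (Suc n)) w - partial_deriv b (v n) w"
    proof (rule partial_deriv_eqI)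
      have wG: "w \<in> G" using w HG by blast
      show "has_partial b ?v (partial_deriv b (v (Suc n)) w - partial_deriv b (v n) w) w"
        using part[OF b wG, of n] part[OF b wG, of "Suc n"]
        unfolding has_partial_def by (rule DERIV_diff[rotated])
    qed
    ultimately show ?thesis by simp
  qed
  have "\<exists>l. \<forall>n. \<forall>w\<in>?H. \<bar>partial_deriv b (v n) w - l w\<bar> \<le> 2 * (4 / d + d) / 2 ^ n" if "b \<in> Basis" for b
    using geometric_uniform_limit[of ?H "\<lambda>n. partial_deriv b (v n)", OF step[OF that]] by metis
  then obtain l where l: "\<And>b n w. b \<in> Basis \<Longrightarrow> w \<in> ?H \<Longrightarrow>
      \<bar>partial_deriv b (v n) w - l b w\<bar> \<le> 2 * (4 / d + d) / 2 ^ n" by metis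
  have "Ck_on (Suc 0) u ?H"
  proof (rule Ck_on_SucI[where D=l])
    show "continuous_on ?H u"
      using continuous_on_weak_laplacian(1)[OF assms] HG by (rule continuous_on_subset)
    fix b :: complex assume b: "b \<in> Basis"
    show "has_partial b u (l b w) w" if "w \<in> ?H" for w
    proof (rule has_partial_limit[OF open_ball that])
      show "has_partial b (v n) (partial_deriv b (v n) y) y" if "y \<in> ?H" for n y
        using part[OF b] HG that by blast
      show "(\<lambda>n. v n y) \<longlonglongrightarrow> u y" if "y \<in> ?H" for y
      proof (rule geometric_tendsto)
        show "\<bar>v n y - u y\<bar> \<le> 1 / 2 ^ n" for n
          using vg(2)[of n, rule_format, OF subsetD[OF HG that]] by simp
      qed
      show "\<bar>partial_deriv b (v n) y - l b y\<bar> \<le> 2 * (4 / d + d) / 2 ^ n" if "y \<in> ?H" for n y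
        by (rule l[OF b that])
    qed
    show "Ck_on 0 (l b) ?H"
      unfolding Ck_on.simps(1)
    proof (rule continuous_on_approx)
      fix e :: real assume "e > 0"
      then obtain n where n: "2 * (4 / d + d) / 2 ^ n < e" by (rule geometric_small)
      have "continuous_on ?H (partial_deriv b (v n))"
        using Ck_2_parts(1)[OF Ck2 b] HG Ck_on_continuous continuous_on_subset by blast
      moreover have "\<forall>w\<in>?H. \<bar>partial_deriv b (v n) w - l b w\<bar> < e"
        using l[OF b, of _ n] n by (meson le_less_trans)
      ultimately show "\<exists>k. continuous_on ?H k \<and> (\<forall>w\<in>?H. \<bar>k w - l b w\<bar> < e)" by blast
    qed
  qed simp
  then show "\<exists>H. open H \<and> z \<in> H \<and> Ck_on (Suc 0) u H" using d(1) by (intro exI[of _ ?H]) auto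
qed

lemma difference_quotient_uniform_limit:
  assumes w: "Ck_on (Suc 0) w G" and b: "b \<in> Basis" and \<rho>: "\<rho> > 0" "cball z0 (2 * \<rho>) \<subseteq> G" and "e > 0"
  obtains \<delta> where "\<delta> > 0" "\<And>t z. \<lbrakk>0 < t; t < \<delta>; z \<in> ball z0 \<rho>\<rbrakk> \<Longrightarrow>
    \<bar>(1 / t) * (w (z + t *\<^sub>R b) - w z) - partial_deriv b w z\<bar> < e"
proof -
  have "continuous_on (cball z0 (2 * \<rho>)) (partial_deriv b w)"
    using Ck_on_partial[OF w b] \<rho>(2) by (auto intro: continuous_on_subset)
  then have "uniformly_continuous_on (cball z0 (2 * \<rho>)) (partial_deriv b w)"
    by (intro compact_uniformly_continuous) auto
  then obtain d where d: "d > 0" "\<And>x y. \<lbrakk>x \<in> cball z0 (2 * \<rho>); y \<in> cball z0 (2 * \<rho>); dist y x < d\<rbrakk> \<Longrightarrow>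
      dist (partial_deriv b w y) (partial_deriv b w x) < e"
    using \<open>e > 0\<close> unfolding uniformly_continuous_on_def by metis
  have nb: "norm b = 1" using b by simp
  show ?thesis
  proof (rule that[of "min d \<rho>"])
    fix t z assume t: "0 < t" "t < min d \<rho>" and z: "z \<in> ball z0 \<rho>"
    have inball: "z + s *\<^sub>R b \<in> cball z0 (2 * \<rho>)" if "0 \<le> s" "s \<le> t" for s
    proof -
      have "dist z (z + s *\<^sub>R b) = s" using that nb by (simp add: dist_norm)
      then show ?thesis using dist_triangle[of z0 "z + s *\<^sub>R b" z] z that t by simp
    qed
    have "\<exists>s. 0 < s \<and> s < t \<and> w (z + t *\<^sub>R b) - w (z + 0 *\<^sub>R b) = (t - 0) * partial_deriv b w (z + s *\<^sub>R b)"
    proof (rule MVT2[OF t(1)])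
      show "((\<lambda>s. w (z + s *\<^sub>R b)) has_real_derivative partial_deriv b w (z + s *\<^sub>R b)) (at s)"
        if "0 \<le> s" "s \<le> t" for s
        using inball[OF that] \<rho>(2) by (intro has_partial_along_line Ck_on_has_partial[OF w b]) auto
    qed
    then obtain s where s: "0 < s" "s < t" "w (z + t *\<^sub>R b) - w z = t * partial_deriv b w (z + s *\<^sub>R b)"
      by auto
    have "dist (partial_deriv b w (z + s *\<^sub>R b)) (partial_deriv b w z) < e"
      using inball[of s] inball[of 0] s t nb by (intro d(2)) (auto simp: dist_norm)
    then show "\<bar>(1 / t) * (w (z + t *\<^sub>R b) - w z) - partial_deriv b w z\<bar> < e"
      unfolding s(3) using t(1) by (simp add: dist_real_def)
  qed (use d \<rho> in auto)
qed

text \<open>Difference quotients of \<open>u\<close> solve the equation whose right side is the difference quotient of \<open>f\<close>,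
  and both converge uniformly on a smaller ball.\<close>

lemma weak_laplacian_partial_deriv:
  assumes u: "weak_laplacian u f G" and f: "Ck_on (Suc 0) f G" and b: "b \<in> Basis"
    and \<rho>: "\<rho> > 0" "cball z0 (2 * \<rho>) \<subseteq> G"
  shows "weak_laplacian (partial_deriv b u) (partial_deriv b f) (ball z0 \<rho>)"
proof (rule weak_laplacian_limit)
  fix e :: real assume e: "e > 0"
  obtain \<delta>1 where \<delta>1: "\<delta>1 > 0" "\<And>t z. \<lbrakk>0 < t; t < \<delta>1; z \<in> ball z0 \<rho>\<rbrakk> \<Longrightarrow>
    \<bar>(1 / t) * (u (z + t *\<^sub>R b) - u z) - partial_deriv b u z\<bar> < e"
    using difference_quotient_uniform_limit[OF weak_laplacian_imp_C1[OF u] b \<rho> e] by blast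
  obtain \<delta>2 where \<delta>2: "\<delta>2 > 0" "\<And>t z. \<lbrakk>0 < t; t < \<delta>2; z \<in> ball z0 \<rho>\<rbrakk> \<Longrightarrow>
    \<bar>(1 / t) * (f (z + t *\<^sub>R b) - f z) - partial_deriv b f z\<bar> < e"
    using difference_quotient_uniform_limit[OF f b \<rho> e] by blast
  define t where "t = min \<rho> (min \<delta>1 \<delta>2) / 2"
  have t: "0 < t" "t < \<delta>1" "t < \<delta>2" "t < \<rho>" using \<delta>1(1) \<delta>2(1) \<rho>(1) by (auto simp: t_def min_def)
  have sub: "ball z0 \<rho> \<subseteq> (\<lambda>z. z + t *\<^sub>R b) -` G"
  proof
    fix z assume z: "z \<in> ball z0 \<rho>"
    have "dist z (z + t *\<^sub>R b) = t" using t b by (simp add: dist_norm)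
    then have "z + t *\<^sub>R b \<in> cball z0 (2 * \<rho>)"
      using dist_triangle[of z0 "z + t *\<^sub>R b" z] z t by simp
    then show "z \<in> (\<lambda>z. z + t *\<^sub>R b) -` G" using \<rho>(2) by auto
  qed
  have sub': "ball z0 \<rho> \<subseteq> G" using \<rho> by (auto simp: subset_iff)
  have "weak_laplacian (\<lambda>z. (1 / t) * (u (z + t *\<^sub>R b) - u z)) (\<lambda>z. (1 / t) * (f (z + t *\<^sub>R b) - f z)) (ball z0 \<rho>)"
    by (intro weak_laplacian_cmult weak_laplacian_diff weak_laplacian_subset[OF u open_ball sub']
        weak_laplacian_subset[OF weak_laplacian_translate[OF u] open_ball sub])
  then show "\<exists>v g. weak_laplacian v g (ball z0 \<rho>) \<and> (\<forall>z\<in>ball z0 \<rho>. \<bar>v z - partial_deriv b u z\<bar> < e \<and>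
      \<bar>g z - partial_deriv b f z\<bar> < e)"
    using \<delta>1(2)[OF t(1,2)] \<delta>2(2)[OF t(1,3)] by blast
qed simp

text \<open>One derivative of \<open>u\<close> exists by the gradient estimate, and the same argument applied to the equation
  for \<open>\<partial>\<^sub>b u\<close> gives the second. That the classical Laplacian is \<open>f\<close> follows from the maximum
  principle for the zero function, whose weak Laplacians \<open>f - \<Delta>u\<close> and \<open>\<Delta>u - f\<close> must be nonpositive.\<close>

theorem weak_laplacian_regularity:
  assumes u: "weak_laplacian u f G" and f: "Ck_on (Suc 0) f G"
  shows "has_laplacian u f G"
proof -
  have G: "open G" using u by (simp add: weak_laplacian_def)
  have "Ck_on (Suc 0) (partial_deriv b u) G" if b: "b \<in> Basis" for b
  proof (rule Ck_on_local)
    fix z assume "z \<in> G"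
    then obtain e where e: "e > 0" "cball z e \<subseteq> G" using G by (meson open_contains_cball)
    then have "weak_laplacian (partial_deriv b u) (partial_deriv b f) (ball z (e / 2))"
      by (intro weak_laplacian_partial_deriv[OF u f b]) auto
    from weak_laplacian_imp_C1[OF this] show "\<exists>H. open H \<and> z \<in> H \<and> Ck_on (Suc 0) (partial_deriv b u) H"
      using e(1) by (intro exI[of _ "ball z (e / 2)"]) auto
  qed
  moreover have C1: "Ck_on (Suc 0) u G" by (rule weak_laplacian_imp_C1[OF u])
  ultimately have C2: "Ck_on 2 u G"
    using Ck_on_has_partial[OF C1] Ck_on_continuous[OF C1]
    unfolding numeral_2_eq_2 by (subst Ck_on_Suc) blast
  then have u': "weak_laplacian u (laplacian u) G"
    by (intro weak_laplacian_classical) (simp add: has_laplacian_def G)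
  have "laplacian u z = f z" if z: "z \<in> G" for z
  proof (rule antisym)
    have "f z - laplacian u z \<le> 0"
      by (rule weak_laplacian_at_max[OF weak_laplacian_diff[OF u u'] z]) simp
    then show "f z \<le> laplacian u z" by simp
    have "laplacian u z - f z \<le> 0"
      by (rule weak_laplacian_at_max[OF weak_laplacian_diff[OF u' u] z]) simp
    then show "laplacian u z \<le> f z" by simp
  qed
  then show ?thesis using C2 G by (simp add: has_laplacian_def)
qed

section \<open>Metrics of curvature minus one\<close>

text \<open>The nonlinearity \<open>exp (2 x)\<close> is not globally Lipschitz. Evaluating it at \<open>min x M\<close> makes it
  so and keeps it monotone and positive.\<close>

lemma truncated_exp_lipschitz:
  fixes M :: real
  shows "\<bar>exp (2 * min x M) - exp (2 * min y M)\<bar> \<le> 2 * exp (2 * M) * \<bar>x - y\<bar>"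
proof -
  have *: "exp (2 * min x M) - exp (2 * min y M) \<le> 2 * exp (2 * M) * (x - y)" if "y \<le> x" for x y
  proof -
    let ?a = "2 * min x M" and ?b = "2 * min y M"
    have ab: "?b \<le> ?a" "?a - ?b \<le> 2 * (x - y)" using that by auto
    have "exp ?b = exp ?a * exp (?b - ?a)" by (simp flip: exp_add)
    moreover have "exp ?a * (1 + (?b - ?a)) \<le> exp ?a * exp (?b - ?a)"
      by (intro mult_left_mono exp_ge_add_one_self) simp
    ultimately have "exp ?a - exp ?b \<le> exp ?a * (?a - ?b)" by (simp add: algebra_simps)
    also have "\<dots> \<le> exp (2 * M) * (2 * (x - y))" using ab by (intro mult_mono) auto
    finally show ?thesis by (simp add: algebra_simps)
  qed
  have mono: "exp (2 * min y M) \<le> exp (2 * min x M)" if "y \<le> x" for x y using that by simp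
  show ?thesis
    using *[of x y] *[of y x] mono[of x y] mono[of y x] by (cases "y \<le> x") auto
qed

text \<open>The truncation is not seen by the solution: its right side is positive, so the solution is
  bounded above by the maximum of its boundary values. As \<open>u\<close> is of class \<open>C\<^sup>1\<close>, so is \<open>exp (2 * u)\<close>, and the regularity
  theorem applies.\<close>

theorem liouville_dirichlet_exists:
  assumes "r > 0" "continuous_on (sphere c r) g"
  obtains u where "continuous_on (cball c r) u" "has_laplacian u (\<lambda>z. exp (2 * u z)) (ball c r)"
    "\<And>z. z \<in> sphere c r \<Longrightarrow> u z = g z"
proof -
  have "compact (g ` sphere c r)" by (intro compact_continuous_image assms) simp
  then have "bounded (g ` sphere c r)" by (rule compact_imp_bounded)
  then obtain M where "\<forall>y\<in>g ` sphere c r. norm y \<le> M" unfolding bounded_iff by blast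
  then have M: "\<bar>g z\<bar> \<le> M" if "z \<in> sphere c r" for z using that by simp
  let ?F = "\<lambda>x. exp (2 * min x M)"
  obtain u where u: "continuous_on (cball c r) u" "weak_laplacian u (\<lambda>z. ?F (u z)) (ball c r)"
    "\<And>z. z \<in> sphere c r \<Longrightarrow> u z = g z"
  proof (rule semilinear_dirichlet_problem[OF assms(1) _ _ _ assms(2)])
    show "mono ?F" by (auto simp: mono_def)
    show "\<bar>?F x - ?F y\<bar> \<le> 2 * exp (2 * M) * \<bar>x - y\<bar>" for x y
      by (rule truncated_exp_lipschitz)
    show "0 \<le> 2 * exp (2 * M)" by simp
  qed (rule that)
  have uM: "u z \<le> M" if "z \<in> cball c r" for z
  proof -
    have "u z \<le> M + 0 * r\<^sup>2 / 4"
    proof (rule disk_upper_bound[OF assms(1) u(1,2) _ _ _ that])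
      show "u z \<le> M" if "z \<in> sphere c r" for z using M[OF that] u(3)[OF that] by simp
    qed auto
    then show ?thesis by simp
  qed
  have weak: "weak_laplacian u (\<lambda>z. exp (2 * u z)) (ball c r)"
    using u(2) by (rule weak_laplacian_cong) (use uM in \<open>auto simp: min_def\<close>)
  have "Ck_on (Suc 0) (\<lambda>z. exp (2 * u z)) (ball c r)"
    by (intro Ck_on_exp Ck_on_cmult weak_laplacian_imp_C1[OF weak]) auto
  then show ?thesis
    using that u(1,3) weak_laplacian_regularity[OF weak] by blast
qed

lemma liouville_dirichlet_le:
  assumes u: "continuous_on (cball c r) u" "has_laplacian u (\<lambda>z. exp (2 * u z)) (ball c r)"
    and v: "continuous_on (cball c r) v" "has_laplacian v (\<lambda>z. exp (2 * v z)) (ball c r)"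
    and eq: "\<And>z. z \<in> sphere c r \<Longrightarrow> u z = v z" and z: "z \<in> cball c r"
  shows "u z \<le> v z"
proof -
  have "u z - v z \<le> 0"
  proof (rule maximum_principle[OF compact_cball ball_subset_cball _ _ _ _ z])
    show "continuous_on (cball c r) (\<lambda>z. u z - v z)" by (intro continuous_intros u v)
    show "weak_laplacian (\<lambda>z. u z - v z) (\<lambda>z. exp (2 * u z) - exp (2 * v z)) (ball c r)"
      by (intro weak_laplacian_classical has_laplacian_diff u v)
    show "u z - v z \<le> 0" if "z \<in> cball c r - ball c r" for z
      using eq[of z] that by simp
  qed simp
  then show ?thesis by simp
qed

lemma has_laplacian_ln_metric:
  assumes "regular_conformal_metric G l" "\<And>z. z \<in> G \<Longrightarrow> curvature l z = - 1"
  shows "has_laplacian (\<lambda>z. ln (l z)) (\<lambda>z. exp (2 * ln (l z))) G"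
proof -
  have G: "open G" and pos: "\<And>z. z \<in> G \<Longrightarrow> l z > 0" and ck: "Ck_on 2 l G"
    using assms(1) by (auto simp: regular_conformal_metric_def)
  have "laplacian (\<lambda>z. ln (l z)) z = exp (2 * ln (l z))" if "z \<in> G" for z
  proof -
    have "exp (2 * ln (l z)) = (l z)\<^sup>2" using pos[OF that] by (simp add: exp_double)
    then show ?thesis
      using assms(2)[OF that] pos[OF that] by (simp add: curvature_def field_simps)
  qed
  then show ?thesis using G Ck_on_ln[OF G ck pos] by (simp add: has_laplacian_def)
qed

theorem theorem4p7:
  fixes c :: complex and r :: real and K :: "complex set" and \<phi> :: "complex \<Rightarrow> real"
  assumes "r > 0" and "K = ball c r"
    and "continuous_on (frontier K) \<phi>" and "\<forall>\<xi>\<in>frontier K. \<phi> \<xi> > 0"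
  shows "\<exists>!l. l \<in> extensional K \<and> regular_conformal_metric K l \<and> (\<forall>z\<in>K. curvature l z = - 1) \<and>
    (\<exists>L. continuous_on (closure K) L \<and> (\<forall>z\<in>K. L z = l z) \<and> (\<forall>\<xi>\<in>frontier K. L \<xi> = \<phi> \<xi>))"
    (is "\<exists>!l. ?P l")
proof (rule ex_ex1I)
  have frontier: "frontier K = sphere c r" and closure: "closure K = cball c r" and K: "open K"
    using assms(1,2) by (auto simp: frontier_ball)
  have "continuous_on (sphere c r) (\<lambda>z. ln (\<phi> z))"
    using assms(3,4) unfolding frontier by (intro continuous_intros) auto
  then obtain u where u: "continuous_on (cball c r) u" "has_laplacian u (\<lambda>z. exp (2 * u z)) K"
    "\<And>z. z \<in> sphere c r \<Longrightarrow> u z = ln (\<phi> z)"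
    using liouville_dirichlet_exists[OF assms(1)] unfolding assms(2) by blast
  define l where "l = restrict (\<lambda>z. exp (u z)) K"
  have l: "l z = exp (u z)" if "z \<in> K" for z using that by (simp add: l_def)
  have "Ck_on 2 (\<lambda>z. exp (u z)) K" using u(2) K by (intro Ck_on_exp) (auto simp: has_laplacian_def)
  then have "Ck_on 2 l K" by (rule Ck_on_cong[OF K, rotated]) (simp add: l)
  then have "regular_conformal_metric K l"
    using K assms(1,2) by (auto simp: regular_conformal_metric_def l)
  moreover have "curvature l z = - 1" if z: "z \<in> K" for z
  proof -
    have "laplacian (\<lambda>w. ln (l w)) z = laplacian u z"
      by (rule laplacian_cong[OF K z]) (simp add: l)
    also have "\<dots> = exp (2 * u z)" using u(2) z by (simp add: has_laplacian_def)
    also have "\<dots> = (l z)\<^sup>2" by (simp add: l[OF z] exp_double)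
    finally show ?thesis by (simp add: curvature_def l[OF z])
  qed
  moreover have "\<exists>L. continuous_on (closure K) L \<and> (\<forall>z\<in>K. L z = l z) \<and> (\<forall>\<xi>\<in>frontier K. L \<xi> = \<phi> \<xi>)"
    using u(1,3) assms(4) unfolding closure frontier
    by (intro exI[of _ "\<lambda>z. exp (u z)"]) (auto intro!: continuous_intros simp: l)
  ultimately show "\<exists>l. ?P l" by (intro exI[of _ l]) (auto simp: l_def)

  \<comment> \<open>uniqueness: logarithms of two such metrics solve the same Dirichlet problem\<close>
  have ln_solution: "\<exists>u. continuous_on (cball c r) u \<and> has_laplacian u (\<lambda>z. exp (2 * u z)) K \<and>
      (\<forall>z\<in>sphere c r. u z = ln (\<phi> z)) \<and> (\<forall>z\<in>K. l z = exp (u z))" if P: "?P l" for l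
  proof -
    obtain L where L: "continuous_on (cball c r) L" "\<And>z. z \<in> K \<Longrightarrow> L z = l z" "\<And>z. z \<in> sphere c r \<Longrightarrow> L z = \<phi> z"
      using P unfolding closure frontier by blast
    have pos: "l z > 0" if "z \<in> K" for z using P that by (simp add: regular_conformal_metric_def)
    have Lpos: "L z > 0" if "z \<in> cball c r" for z
    proof (cases "z \<in> K")
      case True
      then show ?thesis using L(2) pos by simp
    next
      case False
      then have "z \<in> sphere c r" using that assms(2) by simp
      then show ?thesis using L(3) assms(4) frontier by simp
    qed
    have "has_laplacian (\<lambda>z. ln (l z)) (\<lambda>z. exp (2 * ln (l z))) K"
      using P by (intro has_laplacian_ln_metric) auto
    then have "Ck_on 2 (\<lambda>z. ln (l z)) K" and lap: "\<And>z. z \<in> K \<Longrightarrow> laplacian (\<lambda>z. ln (l z)) z = exp (2 * ln (l z))"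
      by (auto simp: has_laplacian_def)
    from this(1) have "Ck_on 2 (\<lambda>z. ln (L z)) K" by (rule Ck_on_cong[OF K, rotated]) (simp add: L)
    moreover have "laplacian (\<lambda>z. ln (L z)) z = exp (2 * ln (L z))" if "z \<in> K" for z
      using laplacian_cong[OF K that, of "\<lambda>z. ln (L z)" "\<lambda>z. ln (l z)"] lap[OF that] that by (simp add: L)
    ultimately have "has_laplacian (\<lambda>z. ln (L z)) (\<lambda>z. exp (2 * ln (L z))) K"
      using K by (simp add: has_laplacian_def)
    moreover have "continuous_on (cball c r) (\<lambda>z. ln (L z))"
      using Lpos by (intro continuous_intros L(1)) force
    moreover have "l z = exp (ln (L z))" if "z \<in> K" for z using pos[OF that] L(2)[OF that] by simp
    ultimately show ?thesis using L(3) by (intro exI[of _ "\<lambda>z. ln (L z)"]) auto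
  qed
  fix l l' assume P: "?P l" and P': "?P l'"
  obtain u where u: "continuous_on (cball c r) u" "has_laplacian u (\<lambda>z. exp (2 * u z)) (ball c r)"
    "\<And>z. z \<in> sphere c r \<Longrightarrow> u z = ln (\<phi> z)" "\<And>z. z \<in> K \<Longrightarrow> l z = exp (u z)"
    using ln_solution[OF P] unfolding assms(2) by blast
  obtain u' where u': "continuous_on (cball c r) u'" "has_laplacian u' (\<lambda>z. exp (2 * u' z)) (ball c r)"
    "\<And>z. z \<in> sphere c r \<Longrightarrow> u' z = ln (\<phi> z)" "\<And>z. z \<in> K \<Longrightarrow> l' z = exp (u' z)"
    using ln_solution[OF P'] unfolding assms(2) by blast
  show "l = l'"
  proof (rule extensionalityI)
    show "l \<in> extensional K" "l' \<in> extensional K" using P P' by auto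
    fix z assume z: "z \<in> K"
    then have z': "z \<in> cball c r" using assms(2) by simp
    have "u z \<le> u' z" by (rule liouville_dirichlet_le[OF u(1,2) u'(1,2) _ z']) (simp add: u u')
    moreover have "u' z \<le> u z" by (rule liouville_dirichlet_le[OF u'(1,2) u(1,2) _ z']) (simp add: u u')
    ultimately show "l z = l' z" using u(4)[OF z] u'(4)[OF z] by simp
  qed
qed

end
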